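(* Let $f$ be an entire function for which there exist constants $A,B,C,r_0>1$ such that \[ A\log M(r,f)\leq \log M(Cr,f)\leq B\log M(r,f)\quad\text{for all } r\geq r_0 . \] Then there exist $\alpha_1,\alpha_2,\eta>0$ such that for all $q,\lambda\geq 0$ we have $\operatorname{dens}\bigl(T(f,\alpha_1,\alpha_2,q,\lambda),A(R)\bigr)>\eta$ for all sufficiently large $R$.
   Context: $M(r,f)=\max_{|z|=r}|f(z)|$. For $R>0$, $A(R)=\{z\in\mathbb C: R\le |z|\le 2R\}$. For measurable $X,Y\subset\mathbb C$ with $0<\operatorname{area}(Y)<\infty$, $\operatorname{dens}(X,Y)=\operatorname{area}(X\cap Y)/\operatorname{area}(Y)$, where area is planar Lebesgue measure. For $\alpha_1,\alpha_2,q,\lambda\ge 0$, $T(f,\alpha_1,\alpha_2,q,\lambda)$ is the set of all $z\in\mathbb C$ such that (i) $\alpha_1\log M(|z|,f)\le \left|\frac{zf'(z)}{f(z)}\right|\le \alpha_2\log M(|z|,f)$; (ii) $|f(z)|\ge |z|^q$; and (iii) $\left|\frac{\zeta f'(\zeta)}{f(\zeta)}\right|\le \alpha_2\log M(|\zeta|,f)$ for all $\zeta$ with $|\zeta-z|\le \lambda |z|/\log M(|z|,f)$ (in particular $f$ has no zeros in this closed disk).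
   Formalization: The entire function f is additionally assumed to be nonconstant; for constant f with |f|=1 the growth condition holds (log M=0), but |f(z)|≥|z|^q fails for q>0 and |z|>1, so the claim is false there. *)

theory Defs
  imports "HOL-Analysis.Analysis"
begin

definition maxmod :: "(complex \<Rightarrow> complex) \<Rightarrow> real \<Rightarrow> real" where
  "maxmod f r = Sup ((\<lambda>z. norm (f z)) ` sphere 0 r)"

definition annulus :: "real \<Rightarrow> complex set" where
  "annulus R = {z. R \<le> norm z \<and> norm z \<le> 2 * R}"

definition dens :: "complex set \<Rightarrow> complex set \<Rightarrow> real" where
  "dens X Y = measure lebesgue (X \<inter> Y) / measure lebesgue Y"

definition Tset :: "(complex \<Rightarrow> complex) \<Rightarrow> real \<Rightarrow> real \<Rightarrow> real \<Rightarrow> real \<Rightarrow> complex set" where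
  "Tset f a1 a2 q lam = {z.
     a1 * ln (maxmod f (norm z)) \<le> norm (z * deriv f z / f z) \<and>
     norm (z * deriv f z / f z) \<le> a2 * ln (maxmod f (norm z)) \<and>
     norm (f z) \<ge> norm z powr q \<and>
     (\<forall>w. dist w z \<le> lam * norm z / ln (maxmod f (norm z)) \<longrightarrow>
          f w \<noteq> 0 \<and> norm (w * deriv f w / f w) \<le> a2 * ln (maxmod f (norm w)))}"

end

theory Submission
  imports Defs "HOL-Complex_Analysis.Complex_Analysis"
begin

unbundle no fps_syntax

text \<open>
  Write \<open>L r = ln (maxmod f r)\<close> and \<open>r = 3R/2\<close>, let \<open>f\<close> attain its maximum modulus on \<open>\<bar>z\<bar> = r\<close> at \<open>z0\<close>, and put
  \<open>F \<zeta> = f (z0 + R \<zeta>)\<close>, \<open>L = L r\<close>. The upper growth bound gives \<open>\<bar>F\<bar> \<le> exp (K L)\<close> on \<open>\<bar>\<zeta>\<bar> \<le> 3\<close>, so \<open>F\<close> has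
  \<open>O(L)\<close> zeros \<open>w\<close> in the unit disc and \<open>\<bar>F'/F\<bar> \<le> O(L) + (\<Sum>w. 1/\<bar>\<zeta> - w\<bar>)\<close> near \<open>0\<close>; as \<open>1/\<bar>\<zeta>\<bar>\<close> is uniformly
  integrable, \<open>F'/F\<close> is \<open>O(L)\<close>, even on discs of radius \<open>O(1/L)\<close>, off a set of small area. The lower growth
  bound and the convexity of \<open>L\<close> in \<open>ln r\<close> give \<open>ln \<bar>F\<bar> \<le> (1 - c) L\<close> on a disc centred closer to the origin of
  the \<open>z\<close>-plane, while subharmonicity gives mean value at least \<open>L\<close> over the congruent disc centred
  at \<open>0\<close>. Hence \<open>\<bar>F'/F\<bar>\<close> has integral at least const \<open>L\<close> over the set where \<open>ln \<bar>F\<bar> \<ge> (1 - c) L\<close>, and by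
  uniform integrability \<open>\<bar>F'/F\<bar> \<ge> const L\<close> on a subset of area bounded below.
\<close>

section \<open>Planar Lebesgue measure\<close>

lemma distr_lborel_vec2_complex:
  "distr (lborel :: (real^2) measure) borel (\<lambda>x. Complex (x$1) (x$2)) = lborel"
proof (rule lborel_eqI[symmetric])
  have cont: "continuous_on UNIV (\<lambda>x::real^2. Complex (x$1) (x$2))"
    unfolding Complex_eq by (intro continuous_intros)
  have [measurable]: "(\<lambda>x::real^2. Complex (x$1) (x$2)) \<in> borel \<rightarrow>\<^sub>M borel"
    using cont by (rule borel_measurable_continuous_onI)
  fix l u :: complex assume le: "\<And>b. b \<in> Basis \<Longrightarrow> l \<bullet> b \<le> u \<bullet> b"
  have le': "Re l \<le> Re u" "Im l \<le> Im u"
    using le[of 1] le[of \<i>] by (auto simp: Basis_complex_def)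
  have *: "(\<lambda>x::real^2. Complex (x$1) (x$2)) -` box l u = box (vector [Re l, Im l]) (vector [Re u, Im u])"
    by (auto simp: box_def Basis_complex_def Basis_vec_def inner_axis forall_2 )
  have "axis 1 (1::real) \<noteq> (axis 2 1 :: real^2)" by (simp add: axis_eq_axis)
  then have "emeasure lborel (box (vector [Re l, Im l]) (vector [Re u, Im u] :: real^2)) = (\<Prod>b\<in>Basis. (u - l) \<bullet> b)"
    using le' by (subst emeasure_lborel_box)
      (auto simp: Basis_complex_def Basis_vec_def inner_axis UNIV_2)
  then show "emeasure (distr (lborel :: (real^2) measure) borel (\<lambda>x. Complex (x$1) (x$2))) (box l u) = (\<Prod>b\<in>Basis. (u - l) \<bullet> b)"
    by (simp add: emeasure_distr *)
qed simp

lemma distr_lborel_rotation: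
  fixes c :: complex
  assumes c: "norm c = 1"
  shows "distr lborel borel ((*) c) = lborel"
proof (rule lborel_eqI[symmetric])
  define p where "p = (\<lambda>x::real^2. Complex (x$1) (x$2))"
  have p_borel [measurable]: "p \<in> borel \<rightarrow>\<^sub>M borel"
    unfolding p_def Complex_eq by (intro borel_measurable_continuous_onI continuous_intros)
  define T where "T = (\<lambda>x::real^2. vector [Re (cnj c * p x), Im (cnj c * p x)] :: real^2)"
  have pT: "p (T x) = cnj c * p x" for x by (simp add: T_def p_def complex_eq_iff)
  have np: "norm (p x) = norm x" for x
    by (simp add: p_def cmod_def norm_vec_def L2_set_def UNIV_2)
  have pinj: "x = y" if "p x = p y" for x y
    using that by (auto simp: p_def vec_eq_iff forall_2)
  have p_lin: "p (x + y) = p x + p y" "p (r *\<^sub>R x) = of_real r * p x" for x y r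
    by (simp_all add: p_def complex_eq_iff)
  have "linear T"
  proof (intro linearI pinj)
    show "p (T (x + y)) = p (T x + T y)" for x y
      by (simp only: pT p_lin distrib_left)
    show "p (T (r *\<^sub>R x)) = p (r *\<^sub>R T x)" for r x
      by (simp only: pT p_lin mult.left_commute)
  qed
  then have T: "orthogonal_transformation T"
    unfolding orthogonal_transformation using c by (simp add: np[symmetric] pT norm_mult)
  have c1: "c * cnj c = 1" using c by (simp add: complex_norm_square[symmetric])
  fix l u :: complex assume le: "\<And>b. b \<in> Basis \<Longrightarrow> l \<bullet> b \<le> u \<bullet> b"
  have ems: "emeasure lborel A = emeasure lborel (p -` A)" if "A \<in> sets borel" for A
    using that emeasure_distr[of p lborel borel A] by (simp add: distr_lborel_vec2_complex[folded p_def])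
  have eq: "p -` ((*) c -` box l u) = T ` (p -` box l u)"
  proof (intro equalityI subsetI)
    fix x assume x: "x \<in> p -` ((*) c -` box l u)"
    define y :: "real^2" where "y = vector [Re (c * p x), Im (c * p x)]"
    have "p y = c * p x" by (simp add: y_def p_def complex_eq_iff)
    moreover from this have "x = T y" using c1
      by (intro pinj) (simp add: pT mult.assoc[symmetric] mult.commute[of "cnj c"])
    ultimately show "x \<in> T ` (p -` box l u)" using x by auto
  next
    fix x assume "x \<in> T ` (p -` box l u)"
    then show "x \<in> p -` ((*) c -` box l u)"
      using c1 by (auto simp: pT mult.assoc[symmetric])
  qed
  have fin: "emeasure lborel (p -` box l u) < \<infinity>"
    using ems[of "box l u"] emeasure_lborel_box_finite[of l u] by simp
  have [measurable]: "p -` box l u \<in> sets borel"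
    using measurable_sets[OF p_borel, of "box l u"] by simp
  have lm: "p -` box l u \<in> lmeasurable"
    using fin by (auto simp: fmeasurable_def)
  have [measurable]: "(*) c \<in> borel \<rightarrow>\<^sub>M borel" 
    by (intro borel_measurable_continuous_onI continuous_intros)
  have [measurable]: "(*) c -` box l u \<in> sets borel"
    using measurable_sets[of "(*) c" borel borel "box l u"] by simp
  have [measurable]: "p -` ((*) c -` box l u) \<in> sets borel"
    using measurable_sets[OF p_borel, of "(*) c -` box l u"] by simp
  have "emeasure lborel ((*) c -` box l u) = emeasure lebesgue (T ` (p -` box l u))"
    by (subst ems) (simp_all add: eq[symmetric])
  also have "\<dots> = emeasure lebesgue (p -` box l u)"
    using measurable_orthogonal_image[OF T lm] measure_orthogonal_image[OF T lm] lm
    by (simp add: emeasure_eq_measure2)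
  also have "\<dots> = emeasure lborel (box l u)"
    by (subst ems) simp_all
  finally show "emeasure (distr lborel borel ((*) c)) (box l u) = (\<Prod>b\<in>Basis. (u - l) \<bullet> b)"
    using le by (simp add: emeasure_distr emeasure_lborel_box)
qed simp

lemma nn_integral_lborel_translate:
  fixes g :: "complex \<Rightarrow> ennreal"
  assumes [measurable]: "g \<in> borel_measurable borel"
  shows "(\<integral>\<^sup>+z. g (a + z) \<partial>lborel) = (\<integral>\<^sup>+z. g z \<partial>lborel)"
  using nn_integral_distr[of "(+) a" lborel borel g] by (simp add: lborel_distr_plus)

lemma emeasure_lborel_disc:
  "s \<ge> 0 \<Longrightarrow> emeasure lborel (ball (w::complex) s) = ennreal (pi * s\<^sup>2)"
  by (simp add: emeasure_ball unit_ball_vol_2 power2_eq_square)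

lemma nn_integral_inverse_dist_disc:
  fixes w :: complex
  assumes s: "s > 0"
  shows "(\<integral>\<^sup>+z\<in>ball w s. ennreal (1 / dist z w) \<partial>lborel) \<le> ennreal (4 * pi * s)"
proof -
  define b where "b = (\<lambda>k::nat. ball w (s / 2^k))"
  have [measurable]: "b k \<in> sets borel" for k by (simp add: b_def)
  have pt: "ennreal (1 / dist z w) * indicator (ball w s) z
          \<le> (\<Sum>k. ennreal (2^(Suc k) / s) * indicator (b k) z)" for z
  proof (cases "z \<in> ball w s \<and> z \<noteq> w")
    case True
    define d where "d = dist z w"
    have d: "0 < d" "d < s" using True by (auto simp: d_def dist_commute)
    obtain n where "(1/2)^n < d / s" using real_arch_pow_inv[of "d/s" "1/2"] d s by auto
    then have ex: "\<exists>n. s / 2^n \<le> d" using s by (intro exI[of _ n]) (auto simp: field_simps power_divide)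
    define k where "k = (LEAST n. s / 2^n \<le> d)"
    have k: "s / 2^k \<le> d" unfolding k_def by (rule LeastI_ex[OF ex])
    have "k \<noteq> 0" using k d by (intro notI) simp
    then obtain j where j: "k = Suc j" using not0_implies_Suc by blast
    have "\<not> s / 2^j \<le> d" using not_less_Least[of j "\<lambda>n. s / 2^n \<le> d"] j by (simp add: k_def)
    then have jd: "d < s / 2^j" by simp
    have "1 / d \<le> 2^Suc j / s" using k d s by (simp add: j field_simps)
    moreover have "z \<in> b j" using jd by (simp add: b_def d_def dist_commute)
    ultimately have "ennreal (1 / dist z w) * indicator (ball w s) z \<le> ennreal (2^(Suc j) / s) * indicator (b j) z"
      using True by (auto simp: d_def intro!: ennreal_leI)
    also have "\<dots> \<le> (\<Sum>k. ennreal (2^(Suc k) / s) * indicator (b k) z)"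
      using sum_le_suminf[of "\<lambda>k. ennreal (2^(Suc k) / s) * indicator (b k) z" "{j}"]
      by (simp del: sum_mult_indicator)
    finally show ?thesis .
  qed auto
  have "(\<integral>\<^sup>+z\<in>ball w s. ennreal (1 / dist z w) \<partial>lborel)
     \<le> (\<integral>\<^sup>+z. (\<Sum>k. ennreal (2^(Suc k) / s) * indicator (b k) z) \<partial>lborel)"
    by (intro nn_integral_mono pt)
  also have "\<dots> = (\<Sum>k. \<integral>\<^sup>+z. ennreal (2^(Suc k) / s) * indicator (b k) z \<partial>lborel)"
    by (intro nn_integral_suminf) measurable
  also have "\<dots> = (\<Sum>k. ennreal (2 * pi * s * (1/2)^k))"
  proof (rule suminf_cong)
    fix k
    have "(\<integral>\<^sup>+z. ennreal (2^(Suc k) / s) * indicator (b k) z \<partial>lborel) = ennreal (2^(Suc k) / s) * ennreal (pi * (s / 2^k)\<^sup>2)"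
      using s by (simp add: nn_integral_cmult_indicator b_def emeasure_lborel_disc)
    also have "\<dots> = ennreal (2^(Suc k) / s * (pi * (s / 2^k)\<^sup>2))"
      using s by (intro ennreal_mult[symmetric]) auto
    also have "2^(Suc k) / s * (pi * (s / 2^k)\<^sup>2) = 2 * pi * s * (1/2)^k"
      using s by (simp add: field_simps power2_eq_square power_divide)
    finally show "(\<integral>\<^sup>+z. ennreal (2^(Suc k) / s) * indicator (b k) z \<partial>lborel) = ennreal (2 * pi * s * (1/2)^k)" .
  qed
  also have "\<dots> = ennreal (4 * pi * s)"
  proof (rule suminf_ennreal_eq)
    have "(\<lambda>k. 2 * pi * s * (1/2)^k) sums (2 * pi * s * (1 / (1 - 1/2)))"
      by (intro sums_mult geometric_sums) simp
    then show "(\<lambda>k. 2 * pi * s * (1/2)^k) sums (4 * pi * s)" by (simp add: mult.assoc)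
  qed (use s in auto)
  finally show ?thesis .
qed

lemma nn_integral_inverse_dist_le:
  fixes w :: complex
  assumes s: "s > 0" and E [measurable]: "E \<in> sets borel" and le: "emeasure lborel E \<le> ennreal m" and "m \<ge> 0"
  shows "(\<integral>\<^sup>+z\<in>E. ennreal (1 / dist z w) \<partial>lborel) \<le> ennreal (4 * pi * s + m / s)"
proof -
  have [measurable]: "ball w s \<in> sets borel" by simp
  have "(\<integral>\<^sup>+z\<in>E. ennreal (1 / dist z w) \<partial>lborel)
     \<le> (\<integral>\<^sup>+z. ennreal (1 / dist z w) * indicator (ball w s) z + ennreal (1/s) * indicator E z \<partial>lborel)"
    using s by (intro nn_integral_mono)
      (auto simp: indicator_def dist_commute frac_le not_less intro!: ennreal_leI)
  also have "\<dots> = (\<integral>\<^sup>+z\<in>ball w s. ennreal (1 / dist z w) \<partial>lborel) + ennreal (1/s) * emeasure lborel E"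
    by (subst nn_integral_add) (simp_all add: nn_integral_cmult_indicator)
  also have "\<dots> \<le> ennreal (4 * pi * s) + ennreal (1/s) * ennreal m"
    using s by (intro add_mono nn_integral_inverse_dist_disc mult_left_mono le) auto
  also have "\<dots> = ennreal (4 * pi * s + m / s)"
    using s \<open>m \<ge> 0\<close> by (simp add: ennreal_mult[symmetric] flip: ennreal_plus)
  finally show ?thesis .
qed

section \<open>Zeros and mean values of entire functions\<close>

lemma entire_factor_zero:
  assumes f: "f holomorphic_on UNIV" and nz: "f a \<noteq> 0" and w: "f w = 0"
  obtains n g where "g holomorphic_on UNIV" "\<And>z. f z = (z - w) ^ n * g z" "g w \<noteq> 0"
proof -
  have "\<not> f constant_on UNIV" using nz w by (metis UNIV_I constant_on_def)
  then obtain g r n where g: "0 < n" "0 < r" "g holomorphic_on ball w r"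
    "\<And>z. z \<in> ball w r \<Longrightarrow> f z = (z - w) ^ n * g z" "\<And>z. z \<in> ball w r \<Longrightarrow> g z \<noteq> 0"
    using holomorphic_factor_zero_nonconstant[OF f, of w] w by (metis UNIV_I connected_UNIV open_UNIV)
  define G where "G z = (if z = w then g w else f z / (z - w) ^ n)" for z
  have "(\<lambda>z. f z / (z - w) ^ n) holomorphic_on (- {w})"
    by (intro holomorphic_intros holomorphic_on_subset[OF f]) auto
  then have "G holomorphic_on (- {w})"
    by (rule holomorphic_transform) (auto simp: G_def)
  moreover have "G holomorphic_on ball w r"
    by (rule holomorphic_transform[OF g(3)]) (auto simp: G_def g(4))
  ultimately have "G holomorphic_on (- {w} \<union> ball w r)"
    by (intro holomorphic_on_Un) auto
  moreover have "- {w} \<union> ball w r = UNIV" using g(2) by auto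
  ultimately have "G holomorphic_on UNIV" by simp
  moreover have "f z = (z - w) ^ n * G z" for z
    using w g(1) by (auto simp: G_def)
  moreover have "G w \<noteq> 0" using g(2,5) by (simp add: G_def)
  ultimately show thesis by (rule that)
qed

lemma entire_finite_zeros:
  assumes f: "f holomorphic_on UNIV" and nz: "f a \<noteq> (0::complex)" and S: "bounded S"
  shows "finite {z \<in> S. f z = 0}"
proof (cases "f constant_on UNIV")
  case True
  then show ?thesis using nz by (auto simp: constant_on_def)
next
  case False
  have "finite {z \<in> closure S. f z = 0}"
    by (rule holomorphic_compact_finite_zeros[OF f]) (use False S in auto)
  then show ?thesis
    by (rule rev_finite_subset) (use closure_subset in auto)
qed

lemma entire_factor_zeros:
  assumes f: "f holomorphic_on UNIV" and nz: "f a \<noteq> 0" and S: "bounded S"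
  obtains Z m g where "finite Z" "Z \<subseteq> {z \<in> S. f z = 0}" "\<And>w. w \<in> Z \<Longrightarrow> m w > 0" "g holomorphic_on UNIV"
    "\<And>z. f z = (\<Prod>w\<in>Z. (z - w) ^ m w) * g z" "\<And>z. z \<in> S \<Longrightarrow> g z \<noteq> 0"
proof -
  have "\<exists>Z m g. finite Z \<and> Z \<subseteq> {z \<in> S. f z = 0} \<and> (\<forall>w\<in>Z. m w > 0) \<and> g holomorphic_on UNIV \<and>
    (\<forall>z. f z = (\<Prod>w\<in>Z. (z - w) ^ m w) * g z) \<and> (\<forall>z\<in>S. g z \<noteq> 0)"
    using f nz
  proof (induction "card {z \<in> S. f z = 0}" arbitrary: f)
    case 0
    then have "{z \<in> S. f z = 0} = {}"
      using entire_finite_zeros[OF 0(2,3) S] by simp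
    then show ?case using 0(2)
      by (intro exI[of _ "{}"] exI[of _ "\<lambda>_. 0"] exI[of _ f]) auto
  next
    case (Suc k)
    then have "card {z \<in> S. f z = 0} \<noteq> 0" by simp
    then have "{z \<in> S. f z = 0} \<noteq> {}" by (metis card.empty)
    then obtain w where w: "w \<in> S" "f w = 0" by blast
    obtain n g where g: "g holomorphic_on UNIV" "\<And>z. f z = (z - w) ^ n * g z" "g w \<noteq> 0"
      using entire_factor_zero[OF Suc.prems w(2)] by metis
    have n: "n \<noteq> 0"
    proof
      assume "n = 0"
      then show False using g(2)[of w] g(3) w(2) by simp
    qed
    have eq: "{z \<in> S. g z = 0} = {z \<in> S. f z = 0} - {w}"
      using g(3) n by (auto simp: g(2))
    have "k = card {z \<in> S. g z = 0}"
      unfolding eq using Suc.hyps(2) w entire_finite_zeros[OF Suc.prems S]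
      by (subst card_Diff_singleton) auto
    moreover have "g a \<noteq> 0" using g(2)[of a] Suc.prems by auto
    ultimately obtain Z h and m :: "complex \<Rightarrow> nat" where h: "finite Z" "Z \<subseteq> {z \<in> S. g z = 0}" "\<forall>w\<in>Z. m w > 0" "h holomorphic_on UNIV"
      "\<And>z. g z = (\<Prod>w\<in>Z. (z - w) ^ m w) * h z" "\<forall>z\<in>S. h z \<noteq> 0"
      using Suc.hyps(1)[of g] g(1) by blast
    define m' where "m' v = (if v = w then (if w \<in> Z then m w else 0) + n else m v)" for v
    have eq': "f z = (\<Prod>v\<in>insert w Z. (z - v) ^ m' v) * h z" for z
    proof (cases "w \<in> Z")
      case True
      then have "Z = insert w (Z - {w})" "finite (Z - {w})" using h by auto
      then obtain Y where Y: "Z = insert w Y" "w \<notin> Y" "finite Y" by blast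
      have "(\<Prod>v\<in>Y. (z - v) ^ m' v) = (\<Prod>v\<in>Y. (z - v) ^ m v)"
        using Y by (intro prod.cong) (auto simp: m'_def)
      then show ?thesis using Y by (simp add: m'_def g(2) h(5) power_add mult_ac)
    next
      case False
      have "(\<Prod>v\<in>Z. (z - v) ^ m' v) = (\<Prod>v\<in>Z. (z - v) ^ m v)"
        using False by (intro prod.cong) (auto simp: m'_def)
      then show ?thesis using False h(1) by (simp add: m'_def g(2) h(5) mult_ac)
    qed
    show ?case
    proof (intro exI conjI allI)
      show "finite (insert w Z)" using h(1) by simp
      show "insert w Z \<subseteq> {z \<in> S. f z = 0}" using h(2) w eq by blast
      show "\<forall>v\<in>insert w Z. m' v > 0" using h(3) n by (simp add: m'_def)
      show "f z = (\<Prod>v\<in>insert w Z. (z - v) ^ m' v) * h z" for z by (rule eq')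
    qed (fact h(4) h(6))+
  qed
  then show thesis using that by blast
qed

lemma ln_norm_circle_mean:
  assumes g: "g holomorphic_on UNIV" and nz: "\<And>z. z \<in> cball 0 1 \<Longrightarrow> g z \<noteq> 0"
  shows "((\<lambda>x. ln (norm (g (exp (2 * of_real pi * \<i> * of_real x))))) has_integral ln (norm (g 0))) {0..1}"
proof -
  have "open (- (g -` {0}))"
    using g by (intro open_Compl closed_vimage) (auto simp: holomorphic_on_imp_continuous_on)
  then have "open {z. g z \<noteq> 0}" by (simp add: vimage_def Compl_eq)
  then obtain e where e: "e > 0" "(\<Union>x\<in>cball 0 1. ball x e) \<subseteq> {z. g z \<noteq> 0}"
    by (rule compact_subset_open_imp_ball_epsilon_subset[of "cball 0 1" "{z. g z \<noteq> 0}", OF compact_cball])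
      (use nz in auto)
  have nz': "g z \<noteq> 0" if "z \<in> ball 0 (1 + e)" for z
  proof (cases "norm z \<le> 1")
    case False
    then have "z \<noteq> 0" by auto
    have "dist (sgn z) z = norm ((norm z - 1) *\<^sub>R sgn z)"
      using \<open>z \<noteq> 0\<close> by (subst dist_commute) (simp add: dist_norm sgn_div_norm algebra_simps del: norm_scaleR)
    also have "\<dots> = norm z - 1" using False \<open>z \<noteq> 0\<close> by (simp add: norm_sgn)
    finally have "norm (sgn z) \<le> 1" "dist (sgn z) z < e"
      using that by (simp_all add: norm_sgn)
    then have "z \<in> (\<Union>x\<in>cball 0 1. ball x e)" by auto
    then show ?thesis using e(2) by blast
  qed (use nz in auto)
  obtain h where h: "h holomorphic_on ball 0 (1 + e)" "\<And>z. z \<in> ball 0 (1 + e) \<Longrightarrow> g z = exp (h z)"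
    by (rule contractible_imp_holomorphic_log[OF holomorphic_on_subset[OF g subset_UNIV]
          convex_imp_contractible[OF convex_ball] nz']) blast+
  have "continuous_on (cball 0 1) h" "h holomorphic_on ball 0 1"
    using h(1) e(1) by (auto intro!: holomorphic_on_imp_continuous_on intro: holomorphic_on_subset)
  then have "((\<lambda>u. h u / (u - 0)) has_contour_integral (2 * of_real pi * \<i> * h 0)) (circlepath 0 1)"
    by (intro Cauchy_integral_circlepath) auto
  then have "((\<lambda>x. 2 * of_real pi * \<i> * h (exp (2 * of_real pi * \<i> * of_real x))) has_integral (2 * of_real pi * \<i> * h 0)) {0..1}"
    unfolding has_contour_integral_def
  proof (rule has_integral_eq[rotated])
    fix x :: real assume "x \<in> {0..1}"
    then have "vector_derivative (circlepath 0 1) (at x within {0..1}) = 2 * of_real pi * \<i> * exp (2 * of_real pi * \<i> * of_real x)"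
      by (simp add: vector_derivative_circlepath01)
    moreover have "circlepath 0 1 x = exp (2 * of_real pi * \<i> * of_real x)"
      by (simp add: circlepath)
    ultimately show "h (circlepath 0 1 x) / (circlepath 0 1 x - 0) * vector_derivative (circlepath 0 1) (at x within {0..1})
        = 2 * of_real pi * \<i> * h (exp (2 * of_real pi * \<i> * of_real x))"
      by (simp only:) simp
  qed
  then have "((\<lambda>x. (1 / (2 * of_real pi * \<i>)) * (2 * of_real pi * \<i> * h (exp (2 * of_real pi * \<i> * of_real x))))
       has_integral ((1 / (2 * of_real pi * \<i>)) * (2 * of_real pi * \<i> * h 0))) {0..1}"
    by (rule has_integral_mult_right)
  then have "((\<lambda>x. h (exp (2 * of_real pi * \<i> * of_real x))) has_integral h 0) {0..1}" by simp
  then have "((\<lambda>x. Re (h (exp (2 * of_real pi * \<i> * of_real x)))) has_integral Re (h 0)) {0..1}"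
    by (rule has_integral_Re)
  moreover have "ln (norm (g z)) = Re (h z)" if "norm z = 1 \<or> z = 0" for z
    using that e(1) by (subst h(2)) auto
  ultimately show ?thesis
    by (simp add: norm_exp_eq_Re)
qed

text \<open>Replacing each factor \<open>z - w\<close>, \<open>\<bar>w\<bar> < 1\<close>, of \<open>f\<close> by \<open>1 - cnj w z\<close> does not change \<open>\<bar>f\<bar>\<close> on the
  unit circle, removes the zero, and does not decrease \<open>\<bar>f 0\<bar>\<close>.\<close>
lemma ln_norm_circle_submean:
  assumes f: "f holomorphic_on UNIV" and f0: "f 0 \<noteq> 0" and nz: "\<And>z. norm z = 1 \<Longrightarrow> f z \<noteq> 0"
  obtains I where "ln (norm (f 0)) \<le> I"
    "((\<lambda>x. ln (norm (f (exp (2 * of_real pi * \<i> * of_real x))))) has_integral I) {0..1}"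
proof -
  obtain Z m g where Z: "finite Z" "Z \<subseteq> ball 0 1" and g: "g holomorphic_on UNIV"
    "\<And>z. f z = (\<Prod>w\<in>Z. (z - w) ^ m w) * g z" "\<And>z. z \<in> ball 0 1 \<Longrightarrow> g z \<noteq> 0"
    by (rule entire_factor_zeros[OF f f0 bounded_ball[of 0 1]]) blast
  define h where "h z = (\<Prod>w\<in>Z. (1 - cnj w * z) ^ m w) * g z" for z
  have h: "h holomorphic_on UNIV"
    unfolding h_def by (intro holomorphic_intros g)
  have hf: "norm (h z) = norm (f z)" if "norm z = 1" for z
  proof -
    have "norm (1 - cnj w * z) = norm (z - w)" for w
    proof -
      have "1 - cnj w * z = z * cnj (z - w)"
        using that complex_norm_square[of z] by (simp add: algebra_simps)
      then show ?thesis using that by (simp add: norm_mult del: complex_cnj_diff)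
    qed
    then show ?thesis by (simp add: h_def g(2) norm_mult norm_power flip: prod_norm)
  qed
  have h_nz: "h z \<noteq> 0" if "z \<in> cball 0 1" for z
  proof (cases "norm z = 1")
    case True
    then show ?thesis using hf nz by (metis norm_eq_zero)
  next
    case False
    have "1 - cnj w * z \<noteq> 0" if "w \<in> Z" for w
    proof
      assume "1 - cnj w * z = 0"
      then have "cnj w * z = 1" by simp
      then have "norm w * norm z = 1" by (metis complex_mod_cnj norm_mult norm_one)
      moreover have "norm w < 1" "norm z \<le> 1" using Z that \<open>z \<in> cball 0 1\<close> by auto
      then have "norm w * norm z \<le> norm w * 1" by (intro mult_left_mono) auto
      ultimately show False using \<open>norm w < 1\<close> by simp
    qed
    then show ?thesis using False that g(3) Z by (auto simp: h_def)
  qed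
  have "((\<lambda>x. ln (norm (h (exp (2 * of_real pi * \<i> * of_real x))))) has_integral ln (norm (h 0))) {0..1}"
    using h h_nz by (rule ln_norm_circle_mean)
  then have "((\<lambda>x. ln (norm (f (exp (2 * of_real pi * \<i> * of_real x))))) has_integral ln (norm (h 0))) {0..1}"
    by (rule has_integral_eq[rotated]) (subst hf, simp_all)
  moreover have "ln (norm (f 0)) \<le> ln (norm (h 0))"
  proof -
    have "norm (\<Prod>w\<in>Z. (0 - w) ^ m w) \<le> 1"
      unfolding prod_norm[symmetric] using Z
      by (intro prod_le_1) (auto simp: norm_power intro!: power_le_one)
    then have "norm (f 0) \<le> norm (h 0)"
      by (simp add: h_def g(2) norm_mult mult_left_le_one_le)
    then show ?thesis using f0 by (intro ln_mono) auto
  qed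
  ultimately show thesis using that by blast
qed

lemma ln_norm_disc_submean:
  assumes f: "f holomorphic_on UNIV" and f0: "f 0 \<noteq> 0" and s: "s > 0" and le: "l \<le> ln (norm (f 0))"
  shows "ennreal (pi * s\<^sup>2 * (ln (norm (f 0)) - l))
    \<le> (\<integral>\<^sup>+z\<in>ball 0 s. ennreal (ln (max (norm (f z)) (exp l)) - l) \<partial>lborel)"
proof -
  define v where "v z = ln (max (norm (f z)) (exp l)) - l" for z
  define u where "u z = ennreal (v z) * indicator (ball 0 s) z" for z
  define c where "c x = exp (2 * of_real pi * \<i> * of_real x)" for x :: real
  have [simp]: "norm (c x) = 1" for x by (simp add: c_def)
  have cont_f: "continuous_on A f" for A
    using f holomorphic_on_imp_continuous_on continuous_on_subset by blast
  have mx: "max (norm (f z)) (exp l) > 0" for z by (simp add: less_max_iff_disj)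
  have v0: "v z \<ge> 0" for z
    using mx[of z] by (simp add: v_def ln_ge_iff)
  have cont_v: "continuous_on A v" for A
    unfolding v_def by (intro continuous_intros cont_f ballI) (use mx less_imp_neq[THEN not_sym] in blast)
  have cont_c: "continuous_on A c" for A unfolding c_def by (intro continuous_intros)
  have [measurable]: "v \<in> borel_measurable borel" "c \<in> borel_measurable borel"
    by (intro borel_measurable_continuous_onI cont_v cont_c)+
  have [measurable]: "ball (0::complex) s \<in> sets borel" by simp
  have [measurable]: "u \<in> borel_measurable borel"
    unfolding u_def by measurable
  have rot: "(\<integral>\<^sup>+z. u (c x * z) \<partial>lborel) = (\<integral>\<^sup>+z. u z \<partial>lborel)" for x
    using nn_integral_distr[of "(*) (c x)" lborel borel u] by (simp add: distr_lborel_rotation)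
  have fin: "finite {w \<in> ball 0 s. f w = 0}"
    using entire_finite_zeros[OF f f0 bounded_ball[of 0 s]] .
  have sphere: "sphere (0::complex) r \<in> null_sets lborel" for r
    using negligible_sphere[of "0::complex" r] by (auto simp: null_sets_completion_iff negligible_iff_null_sets)
  have "(\<Union>w\<in>{w \<in> ball 0 s. f w = 0}. sphere (0::complex) (norm w)) \<in> null_sets lborel"
    by (intro null_sets_UN' countable_finite fin sphere)
  then have ae: "AE z in lborel. z \<notin> (\<Union>w\<in>{w \<in> ball 0 s. f w = 0}. sphere (0::complex) (norm w))"
    by (rule AE_not_in)
  have key: "ennreal (ln (norm (f 0)) - l) \<le> (\<integral>\<^sup>+x\<in>{0..1}. ennreal (v (c x * z)) \<partial>lborel)"
    if z: "z \<in> ball 0 s" "z \<notin> (\<Union>w\<in>{w \<in> ball 0 s. f w = 0}. sphere (0::complex) (norm w))" for z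
  proof -
    have *: "(\<lambda>\<zeta>. f (\<zeta> * z)) holomorphic_on UNIV"
      using f by (rule holomorphic_on_compose_gen[of "\<lambda>\<zeta>. \<zeta> * z" UNIV f UNIV, unfolded o_def, rotated])
        (auto intro!: holomorphic_intros)
    have nz: "f (\<zeta> * z) \<noteq> 0" if "norm \<zeta> = 1" for \<zeta>
      using z that by (auto simp: norm_mult)
    obtain I where I: "ln (norm (f 0)) \<le> I" "((\<lambda>x. ln (norm (f (c x * z)))) has_integral I) {0..1}"
      using ln_norm_circle_submean[OF *] f0 nz by (auto simp: c_def)
    have int: "(\<lambda>x. v (c x * z)) integrable_on {0..1}"
      by (intro integrable_continuous_real continuous_on_compose2[OF cont_v[of UNIV]] continuous_intros cont_c) auto
    have "((\<lambda>x. ln (norm (f (c x * z))) - l) has_integral (I - l)) {0..1}"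
      using has_integral_diff[OF I(2) has_integral_const_real[of l 0 1]] by simp
    then have "I - l \<le> integral {0..1} (\<lambda>x. v (c x * z))"
    proof (rule has_integral_le[OF _ integrable_integral[OF int]])
      fix x :: real
      show "ln (norm (f (c x * z))) - l \<le> v (c x * z)"
        using nz[of "c x"] by (simp add: v_def less_max_iff_disj)
    qed
    then have "ennreal (ln (norm (f 0)) - l) \<le> ennreal (integral {0..1} (\<lambda>x. v (c x * z)))"
      using I(1) by (intro ennreal_leI) simp
    also have "\<dots> = (\<integral>\<^sup>+x. indicator {0..1} x * v (c x * z) \<partial>lborel)"
      using nn_integral_has_integral_lebesgue[OF _ integrable_integral[OF int]] v0 by simp
    also have "\<dots> = (\<integral>\<^sup>+x\<in>{0..1}. ennreal (v (c x * z)) \<partial>lborel)"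
      by (intro nn_integral_cong) (auto simp: indicator_def)
    finally show ?thesis .
  qed
  have "ennreal (pi * s\<^sup>2 * (ln (norm (f 0)) - l)) = (\<integral>\<^sup>+(z::complex). ennreal (ln (norm (f 0)) - l) * indicator (ball 0 s) z \<partial>lborel)"
    using s le by (subst nn_integral_cmult_indicator) (auto simp: emeasure_lborel_disc ennreal_mult[symmetric] mult.commute)
  also have "\<dots> \<le> (\<integral>\<^sup>+z. (\<integral>\<^sup>+x\<in>{0..1}. u (c x * z) \<partial>lborel) \<partial>lborel)"
  proof (rule nn_integral_mono_AE, use ae in eventually_elim)
    case (elim z)
    show ?case
    proof (cases "z \<in> ball 0 s")
      case True
      then have "u (c x * z) = ennreal (v (c x * z))" for x by (simp add: u_def norm_mult)
      then show ?thesis using key[OF True elim] True by simp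
    qed simp
  qed
  also have "\<dots> = (\<integral>\<^sup>+x. (\<integral>\<^sup>+z. u (c x * z) * indicator {0..1} x \<partial>lborel) \<partial>lborel)"
    by (rule lborel_pair.Fubini') measurable
  also have "\<dots> = (\<integral>\<^sup>+x. (\<integral>\<^sup>+z. u z \<partial>lborel) * indicator {0..1::real} x \<partial>lborel)"
    by (subst nn_integral_multc) (auto simp: rot)
  also have "\<dots> = (\<integral>\<^sup>+z. u z \<partial>lborel)"
    by (subst nn_integral_cmult_indicator) simp_all
  finally show ?thesis by (simp add: u_def v_def)
qed

text \<open>Borel--Caratheodory: \<open>(h - h 0) / (2 M - (h - h 0))\<close> maps the unit disc to itself for a
  logarithm \<open>h\<close> of \<open>g\<close>.\<close>
lemma nonvanishing_log_deriv_bound: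
  assumes g: "g holomorphic_on ball 0 1" and nz: "\<And>z. z \<in> ball 0 1 \<Longrightarrow> g z \<noteq> 0"
    and bd: "\<And>z. z \<in> ball 0 1 \<Longrightarrow> norm (g z) \<le> exp M" and g0: "norm (g 0) > 1" and z: "norm z \<le> 1/2"
  shows "norm (deriv g z / g z) \<le> 24 * M"
proof -
  obtain h where h: "h holomorphic_on ball 0 1" "\<And>z. z \<in> ball 0 1 \<Longrightarrow> g z = exp (h z)"
    by (rule contractible_imp_holomorphic_log[OF g convex_imp_contractible[OF convex_ball] nz]) blast+
  have Re_h: "Re (h z) \<le> M" if "z \<in> ball 0 1" for z
    using bd[OF that] h(2)[OF that] by (simp add: norm_exp_eq_Re)
  have Re_h0: "Re (h 0) > 0"
    using g0 h(2)[of 0] by (simp add: norm_exp_eq_Re)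
  have M: "M > 0" using Re_h[of 0] Re_h0 by simp
  define \<psi> where "\<psi> z = h z - h 0" for z
  have \<psi>: "\<psi> holomorphic_on ball 0 1"
    unfolding \<psi>_def by (intro holomorphic_intros h)
  have Re_\<psi>: "Re (\<psi> z) < M" if "z \<in> ball 0 1" for z
    using Re_h[OF that] Re_h0 by (simp add: \<psi>_def)
  have ne: "2 * of_real M - \<psi> z \<noteq> 0" if "z \<in> ball 0 1" for z
  proof
    assume "2 * of_real M - \<psi> z = 0"
    then have "Re (2 * of_real M - \<psi> z) = 0" by simp
    then show False using Re_\<psi>[OF that] M by simp
  qed
  define \<omega> where "\<omega> z = \<psi> z / (2 * of_real M - \<psi> z)" for z
  have \<omega>: "\<omega> holomorphic_on ball 0 1"
    unfolding \<omega>_def by (intro holomorphic_intros \<psi> ne)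
  have \<omega>1: "norm (\<omega> z) < 1" if "norm z < 1" for z
  proof -
    have z: "z \<in> ball 0 1" using that by simp
    have "M * Re (\<psi> z) < M * M" using Re_\<psi>[OF z] M by simp
    then have "(norm (\<psi> z))\<^sup>2 < (norm (2 * of_real M - \<psi> z))\<^sup>2"
      unfolding cmod_power2 by (simp add: power2_eq_square algebra_simps)
    then have "norm (\<psi> z) < norm (2 * of_real M - \<psi> z)"
      by (rule power2_less_imp_less) simp
    then show ?thesis using ne[OF z] by (simp add: \<omega>_def norm_divide)
  qed
  have \<psi>_bd: "norm (\<psi> z) \<le> 6 * M" if "norm z \<le> 3/4" for z
  proof -
    have z: "z \<in> ball 0 1" using that by simp
    have "norm (\<omega> z) \<le> norm z"
      by (rule Schwarz_Lemma(1)[OF \<omega> _ \<omega>1]) (use z in \<open>auto simp: \<omega>_def \<psi>_def\<close>)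
    then have "norm (\<omega> z) \<le> 3/4" using that by simp
    then have "norm (\<psi> z) \<le> 3/4 * norm (2 * of_real M - \<psi> z)"
      using ne[OF z] by (simp add: \<omega>_def norm_divide field_simps)
    also have "norm (2 * of_real M - \<psi> z) \<le> 2 * M + norm (\<psi> z)"
      using norm_triangle_ineq4[of "2 * of_real M" "\<psi> z"] M by (simp add: norm_mult)
    finally show ?thesis by simp
  qed
  have sub: "cball z (1/4) \<subseteq> ball 0 1"
  proof
    fix x assume "x \<in> cball z (1/4)"
    then show "x \<in> ball 0 1"
      using norm_triangle_sub[of x z] z by (simp add: dist_norm norm_minus_commute)
  qed
  have "norm ((deriv ^^ 1) \<psi> z) \<le> fact 1 * (6 * M) / (1/4)^1"
  proof (rule Cauchy_inequality)
    show "\<psi> holomorphic_on ball z (1/4)"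
      using \<psi> sub ball_subset_cball by (blast intro: holomorphic_on_subset)
    show "continuous_on (cball z (1/4)) \<psi>"
      using \<psi> sub holomorphic_on_imp_continuous_on continuous_on_subset by blast
    fix x assume "norm (z - x) = 1/4"
    then have "norm x \<le> 3/4" using z norm_triangle_sub[of x z] by (simp add: norm_minus_commute)
    then show "norm (\<psi> x) \<le> 6 * M" by (rule \<psi>_bd)
  qed simp
  then have bound: "norm (deriv \<psi> z) \<le> 24 * M" by simp
  have zb: "z \<in> ball 0 1" using z by simp
  have dh: "(h has_field_derivative deriv h z) (at z)"
    using h(1) zb by (intro holomorphic_derivI) auto
  have "(\<psi> has_field_derivative deriv h z) (at z)"
    unfolding \<psi>_def using dh by (auto intro!: derivative_eq_intros)
  then have d1: "deriv \<psi> z = deriv h z" by (rule DERIV_imp_deriv)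
  have "((\<lambda>z. exp (h z)) has_field_derivative exp (h z) * deriv h z) (at z)"
    using dh by (auto intro!: derivative_eq_intros)
  then have "(g has_field_derivative exp (h z) * deriv h z) (at z)"
    by (rule has_field_derivative_transform_within_open[OF _ open_ball zb]) (simp add: h(2))
  then have "deriv g z = g z * deriv h z" using h(2)[OF zb] by (simp add: DERIV_imp_deriv)
  then have "deriv g z / g z = deriv \<psi> z" using nz[OF zb] d1 by simp
  then show ?thesis using bound by simp
qed

lemma three_circles_rat:
  assumes f: "f holomorphic_on UNIV" and r1: "0 < r1" and z: "r1 \<le> norm z" "norm z \<le> r2"
    and a: "\<And>w. norm w = r1 \<Longrightarrow> norm (f w) \<le> exp a" and b: "\<And>w. norm w = r2 \<Longrightarrow> norm (f w) \<le> exp b"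
    and nz: "f z \<noteq> 0" and n: "n > 0"
  shows "ln (norm (f z)) - real p / real n * ln (norm z) \<le> max (a - real p / real n * ln r1) (b - real p / real n * ln r2)"
    (is "_ \<le> ?m")
proof -
  define S where "S = {w::complex. r1 \<le> norm w \<and> norm w \<le> r2}"
  define F where "F w = f w ^ n / w ^ p" for w
  have r2: "r2 > 0" using r1 z by linarith
  have F: "F holomorphic_on - {0}"
    unfolding F_def by (intro holomorphic_intros holomorphic_on_subset[OF f]) auto
  have S0: "S \<subseteq> - {0}" using r1 by (auto simp: S_def)
  have cS: "closed S" unfolding S_def by (intro closed_Collect_conj closed_Collect_le continuous_intros)
  have bound: "norm (F w) \<le> exp (real n * ?m)"
    if w: "norm w = r" and c: "norm (f w) \<le> exp c" and r: "r > 0" and m: "c - real p / real n * ln r \<le> ?m" for w r c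
  proof -
    have "norm (F w) \<le> exp c ^ n / r ^ p"
      using w c r by (auto simp: F_def norm_divide norm_power intro!: divide_right_mono power_mono)
    also have "\<dots> = exp (real n * c - real p * ln r)"
      using r by (simp add: exp_diff exp_of_nat_mult)
    also have "real n * c - real p * ln r = real n * (c - real p / real n * ln r)"
      using n by (simp add: field_simps)
    finally show ?thesis using m n by (smt (verit) exp_le_cancel_iff mult_left_mono of_nat_0_le_iff)
  qed
  have "norm (F z) \<le> exp (real n * ?m)"
  proof (rule maximum_modulus_frontier[of F S])
    show "F holomorphic_on interior S"
      using F S0 interior_subset by (blast intro: holomorphic_on_subset)
    show "continuous_on (closure S) F"
      using F S0 cS by (metis closure_closed continuous_on_subset holomorphic_on_imp_continuous_on)
    show "bounded S" by (rule bounded_subset[OF bounded_cball[of 0 r2]]) (auto simp: S_def)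
    show "z \<in> S" using z by (simp add: S_def)
    fix w assume w: "w \<in> frontier S"
    have "open {w::complex. r1 < norm w \<and> norm w < r2}"
      by (intro open_Collect_conj open_Collect_less continuous_intros)
    then have "{w. r1 < norm w \<and> norm w < r2} \<subseteq> interior S"
      by (rule interior_maximal[rotated]) (auto simp: S_def)
    then have "norm w = r1 \<or> norm w = r2"
      using w cS by (force simp: frontier_def S_def)
    then show "norm (F w) \<le> exp (real n * ?m)"
      using bound[of w r1 a] bound[of w r2 b] a b r1 r2 by auto
  qed
  moreover have "norm (F z) = exp (real n * ln (norm (f z)) - real p * ln (norm z))"
  proof -
    have "norm z > 0" using z r1 by linarith
    then have "z \<noteq> 0" by auto
    then show ?thesis
      using nz by (simp add: F_def norm_divide norm_power exp_diff exp_of_nat_mult)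
  qed
  ultimately have "real n * ln (norm (f z)) - real p * ln (norm z) \<le> real n * ?m" by simp
  then have "real n * (ln (norm (f z)) - real p / real n * ln (norm z)) \<le> real n * ?m"
    using n by (simp add: right_diff_distrib)
  then show ?thesis using n by (simp only: mult_le_cancel_left_pos of_nat_0_less_iff)
qed

lemma three_circles:
  assumes f: "f holomorphic_on UNIV" and r1: "0 < r1" and z: "r1 \<le> norm z" "norm z \<le> r2"
    and a: "\<And>w. norm w = r1 \<Longrightarrow> norm (f w) \<le> exp a" and b: "\<And>w. norm w = r2 \<Longrightarrow> norm (f w) \<le> exp b"
    and nz: "f z \<noteq> 0" and \<alpha>: "\<alpha> \<ge> 0"
  shows "ln (norm (f z)) - \<alpha> * ln (norm z) \<le> max (a - \<alpha> * ln r1) (b - \<alpha> * ln r2)"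
proof (rule ccontr)
  let ?U = "{\<beta>. max (a - \<beta> * ln r1) (b - \<beta> * ln r2) < ln (norm (f z)) - \<beta> * ln (norm z)}"
  assume "\<not> ?thesis"
  then have mem: "\<alpha> \<in> ?U" by (simp only: mem_Collect_eq not_le)
  have "open ?U" by (intro open_Collect_less continuous_intros)
  then obtain e where e: "e > 0" "ball \<alpha> e \<subseteq> ?U" using mem by (rule openE)
  obtain q where q: "q \<in> \<rat>" "\<alpha> < q" "q < \<alpha> + e" using Rats_dense_in_real[of \<alpha> "\<alpha> + e"] e by auto
  from q(1) obtain p n :: nat where pn: "n \<noteq> 0" "\<bar>q\<bar> = real p / real n" by (rule Rats_abs_nat_div_natE)
  have n0: "n > 0" using pn(1) by simp
  have q_eq: "q = real p / real n" using pn(2) q(2) \<alpha> by simp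
  have "q \<in> ball \<alpha> e" using q by (simp add: dist_real_def)
  then have "q \<in> ?U" using e(2) by (rule rev_subsetD)
  moreover have "ln (norm (f z)) - q * ln (norm z) \<le> max (a - q * ln r1) (b - q * ln r2)"
    unfolding q_eq using f r1 z a b nz n0 by (rule three_circles_rat)
  ultimately show False by (simp only: mem_Collect_eq not_le[symmetric] not_True_eq_False)
qed

text \<open>Only the part of the segment after its last point with \<open>\<bar>f\<bar> \<le> exp l\<close> contributes.\<close>
lemma ln_max_norm_increment_le:
  fixes a b :: complex
  assumes f: "f holomorphic_on UNIV" and a: "norm (f a) \<le> exp l"
  defines "p \<equiv> \<lambda>x. a + of_real x * (b - a)"
  shows "ennreal (ln (max (norm (f b)) (exp l)) - l)
    \<le> (\<integral>\<^sup>+x\<in>{0..1}. ennreal (norm (b - a) * norm (deriv f (p x) / f (p x))) * indicator {z. exp l \<le> norm (f z)} (p x) \<partial>lborel)"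
proof (cases "norm (f b) \<le> exp l")
  case True
  then show ?thesis by (simp add: max_def)
next
  case False
  have cont_f: "continuous_on A f" for A
    using f holomorphic_on_imp_continuous_on continuous_on_subset by blast
  have cont_p: "continuous_on A p" for A unfolding p_def by (intro continuous_intros)
  have cont_fp: "continuous_on A (\<lambda>x. f (p x))" for A
    by (rule continuous_on_compose2[OF cont_f cont_p]) auto
  have "{x \<in> {0..1}. norm (f (p x)) \<le> exp l} = {0..1} \<inter> {x. norm (f (p x)) \<le> exp l}" by auto
  moreover have "closed {x. norm (f (p x)) \<le> exp l}"
    by (intro closed_Collect_le continuous_intros cont_fp)
  ultimately have comp: "compact {x \<in> {0..1}. norm (f (p x)) \<le> exp l}"
    by (simp add: compact_Int_closed)
  have p0: "p 0 = a" "p 1 = b" by (simp_all add: p_def)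
  have "0 \<in> {x \<in> {0..1}. norm (f (p x)) \<le> exp l}" using a p0 by simp
  then obtain s where s: "s \<in> {0..1}" "norm (f (p s)) \<le> exp l"
    and s_max: "\<And>x. x \<in> {0..1} \<Longrightarrow> norm (f (p x)) \<le> exp l \<Longrightarrow> x \<le> s"
    using compact_attains_sup[OF comp] by blast
  have "s \<noteq> 1" using s False p0 by auto
  then have s1: "s < 1" "0 \<le> s" using s by auto
  have "\<exists>x\<ge>s. x \<le> 1 \<and> norm (f (p x)) = exp l"
    using s False p0 s1 by (intro IVT') (auto intro!: continuous_intros cont_fp)
  then have fs: "norm (f (p s)) = exp l"
    using s_max s by (metis atLeastAtMost_iff order.trans order_antisym order_refl)
  have ge: "exp l \<le> norm (f (p x))" if "x \<in> {s..1}" for x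
  proof (rule ccontr)
    assume "\<not> exp l \<le> norm (f (p x))"
    then have "x = s" using that s_max[of x] s1 by auto
    then show False using \<open>\<not> exp l \<le> norm (f (p x))\<close> fs by simp
  qed
  have nz: "f (p x) \<noteq> 0" if "x \<in> {s..1}" for x
    using ge[OF that] by (metis exp_gt_zero norm_zero not_le)
  define k where "k x = norm (b - a) * norm (deriv f (p x) / f (p x))" for x
  have "deriv f holomorphic_on UNIV" using f by (intro holomorphic_deriv) auto
  then have cont_df: "continuous_on A (deriv f)" for A
    using holomorphic_on_imp_continuous_on continuous_on_subset by blast
  have "continuous_on {s..1} k"
    unfolding k_def by (intro continuous_intros continuous_on_compose2[OF cont_df cont_p] cont_fp) (use nz in auto)
  then have k_int: "k integrable_on {s..1}" by (rule integrable_continuous_real)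
  define D where "D x = (deriv f (p x) * (b - a)) \<bullet> sgn (f (p x)) / norm (f (p x))" for x
  have "((\<lambda>x. ln (norm (f (p x)))) has_vector_derivative D x) (at x within {s..1})" if x: "x \<in> {s..1}" for x
  proof -
    have "(p has_vector_derivative (b - a)) (at x within {s..1})"
      unfolding p_def by (auto intro!: derivative_eq_intros)
    moreover have "(f has_field_derivative deriv f (p x)) (at (p x))"
      using f by (intro holomorphic_derivI) auto
    ultimately have "((\<lambda>x. f (p x)) has_vector_derivative (b - a) * deriv f (p x)) (at x within {s..1})"
      using field_vector_diff_chain_within[of p "b - a" x "{s..1}" f "deriv f (p x)"]
      by (simp add: o_def has_field_derivative_at_within)
    then have "((\<lambda>x. f (p x)) has_derivative (\<lambda>h. h *\<^sub>R (deriv f (p x) * (b - a)))) (at x within {s..1})"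
      by (simp add: has_vector_derivative_def mult.commute)
    then have "((\<lambda>x. norm (f (p x))) has_derivative (\<lambda>h. (h *\<^sub>R (deriv f (p x) * (b - a))) \<bullet> sgn (f (p x)))) (at x within {s..1})"
      by (rule has_derivative_compose[where g = norm and g' = "\<lambda>h. h \<bullet> sgn (f (p x))"])
        (rule has_derivative_norm[OF nz[OF x]])
    then have "((\<lambda>x. norm (f (p x))) has_field_derivative (deriv f (p x) * (b - a)) \<bullet> sgn (f (p x))) (at x within {s..1})"
      by (simp add: has_field_derivative_def mult_commute_abs)
    then have "((\<lambda>x. ln (norm (f (p x)))) has_field_derivative D x) (at x within {s..1})"
      using nz[OF x] unfolding D_def by (auto intro!: derivative_eq_intros)
    then show ?thesis by (simp add: has_real_derivative_iff_has_vector_derivative)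
  qed
  then have FTC: "(D has_integral (ln (norm (f (p 1))) - ln (norm (f (p s))))) {s..1}"
    using s1 by (intro fundamental_theorem_of_calculus) auto
  have "D x \<le> k x" for x
  proof -
    have "(deriv f (p x) * (b - a)) \<bullet> sgn (f (p x)) \<le> norm (deriv f (p x) * (b - a)) * norm (sgn (f (p x)))"
      by (rule norm_cauchy_schwarz)
    also have "\<dots> \<le> norm (deriv f (p x) * (b - a))"
      by (simp add: norm_sgn)
    finally show ?thesis
      by (simp add: D_def k_def norm_mult norm_divide divide_right_mono mult.commute)
  qed
  then have "ln (norm (f b)) - l \<le> integral {s..1} k"
    using has_integral_le[OF FTC integrable_integral[OF k_int]] fs p0 by simp
  moreover have "max (norm (f b)) (exp l) = norm (f b)" using False by simp
  ultimately have "ennreal (ln (max (norm (f b)) (exp l)) - l) \<le> ennreal (integral {s..1} k)"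
    by (intro ennreal_leI) simp
  also have "\<dots> = (\<integral>\<^sup>+x. indicator {s..1} x * k x \<partial>lborel)"
    by (rule nn_integral_has_integral_lebesgue[symmetric, OF _ integrable_integral[OF k_int]]) (simp add: k_def)
  also have "\<dots> \<le> (\<integral>\<^sup>+x\<in>{0..1}. ennreal (norm (b - a) * norm (deriv f (p x) / f (p x))) * indicator {z. exp l \<le> norm (f z)} (p x) \<partial>lborel)"
    using ge s1 by (intro nn_integral_mono) (auto simp: indicator_def k_def)
  finally show ?thesis .
qed

section \<open>The logarithmic derivative near a point of maximum modulus\<close>

lemma has_field_derivative_prod_powers:
  fixes z :: complex
  assumes "finite Z" "z \<notin> Z"
  shows "((\<lambda>z. \<Prod>w\<in>Z. (z - w) ^ m w) has_field_derivative
    (\<Prod>w\<in>Z. (z - w) ^ m w) * (\<Sum>w\<in>Z. of_nat (m w) / (z - w))) (at z)"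
  using assms
proof (induction Z)
  case (insert v Z)
  have "z \<noteq> v" using insert by auto
  have "(z - v) ^ m v / (z - v) * of_nat (m v) = of_nat (m v) * (z - v) ^ (m v - Suc 0)"
    using \<open>z \<noteq> v\<close> by (cases "m v") auto
  then have *: "((\<lambda>z. (z - v) ^ m v) has_field_derivative (z - v) ^ m v * (of_nat (m v) / (z - v))) (at z)"
    by (auto intro!: derivative_eq_intros)
  show ?case
    using insert DERIV_mult[OF * insert.IH] by (simp add: algebra_simps)
qed simp

lemma log_deriv_zeros_bound:
  assumes F: "F holomorphic_on UNIV" and L: "L > 0" and F0: "exp L \<le> norm (F 0)"
    and bd: "\<And>z. norm z \<le> 3 \<Longrightarrow> norm (F z) \<le> exp (K * L)"
  obtains Z :: "complex set" and m where "finite Z" "\<And>w. w \<in> Z \<Longrightarrow> F w = 0" "\<And>w. w \<in> Z \<Longrightarrow> m w > 0"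
    "(\<Sum>w\<in>Z. real (m w)) \<le> 2 * K * L"
    "\<And>z. norm z \<le> 1/2 \<Longrightarrow> z \<notin> Z \<Longrightarrow>
      F z \<noteq> 0 \<and> norm (deriv F z / F z) \<le> 24 * K * L + (\<Sum>w\<in>Z. real (m w) / dist z w)"
proof -
  have "exp 0 < norm (F 0)" using L by (intro less_le_trans[OF _ F0]) simp
  then have F0': "F 0 \<noteq> 0" by auto
  obtain Z m g where Z: "finite Z" "Z \<subseteq> {z \<in> ball 0 1. F z = 0}" "\<And>w. w \<in> Z \<Longrightarrow> m w > 0"
    and g: "g holomorphic_on UNIV" "\<And>z. F z = (\<Prod>w\<in>Z. (z - w) ^ m w) * g z" "\<And>z. z \<in> ball 0 1 \<Longrightarrow> g z \<noteq> 0"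
    by (rule entire_factor_zeros[OF F F0' bounded_ball[of 0 1]]) blast
  define Q where "Q z = (\<Prod>w\<in>Z. (z - w) ^ m w)" for z
  define N where "N = (\<Sum>w\<in>Z. m w)"
  have Q3: "2 ^ N \<le> norm (Q z)" if "norm z = 3" for z
  proof -
    have "2 \<le> norm (z - w)" if "w \<in> Z" for w
    proof -
      have "norm w < 1" using Z that by auto
      then show ?thesis using norm_triangle_ineq2[of z w] \<open>norm z = 3\<close> by simp
    qed
    then have "(\<Prod>w\<in>Z. 2 ^ m w) \<le> (\<Prod>w\<in>Z. norm ((z - w) ^ m w))"
      by (intro prod_mono) (auto simp: norm_power power_mono)
    then show ?thesis by (simp add: Q_def N_def power_sum prod_norm)
  qed
  have g_bd: "norm (g z) \<le> exp (K * L) / 2 ^ N" if "norm z \<le> 3" for z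
  proof (rule maximum_modulus_frontier[of g "cball 0 3"])
    show "g holomorphic_on interior (cball 0 3)" "continuous_on (closure (cball 0 3)) g"
      using g(1) by (auto intro: holomorphic_on_subset continuous_on_subset dest: holomorphic_on_imp_continuous_on)
    fix w :: complex assume "w \<in> frontier (cball 0 3)"
    then have w: "norm w = 3" by simp
    have "2 ^ N * norm (g w) \<le> norm (Q w) * norm (g w)"
      by (intro mult_right_mono Q3 w) simp
    also have "\<dots> = norm (F w)" by (simp add: g(2) Q_def norm_mult)
    also have "\<dots> \<le> exp (K * L)" using w by (intro bd) simp
    finally show "norm (g w) \<le> exp (K * L) / 2 ^ N" by (simp add: field_simps)
  qed (use that in auto)
  have "norm (Q 0) \<le> 1"
    unfolding Q_def prod_norm[symmetric] using Z(2)
    by (intro prod_le_1) (auto simp: norm_power intro!: power_le_one)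
  then have "norm (F 0) \<le> norm (g 0)"
    by (simp add: g(2) Q_def norm_mult mult_left_le_one_le)
  then have g0: "exp L \<le> norm (g 0)" using F0 by linarith
  have "exp L * 2 ^ N \<le> exp (K * L)"
    using g0 g_bd[of 0] by (simp add: field_simps) (metis mult.commute mult_right_mono order_trans zero_le_numeral zero_le_power)
  moreover have "(2::real) ^ N = exp (real N * ln 2)" by (simp add: exp_of_nat_mult)
  ultimately have "L + real N * ln 2 \<le> K * L" by (simp add: exp_add[symmetric])
  moreover have "real N * (1/2) \<le> real N * ln 2"
    using ln2_ge_two_thirds by (intro mult_left_mono) auto
  ultimately have N: "real N \<le> 2 * K * L" using L by simp
  have g_bd1: "norm (g z) \<le> exp (K * L)" if "z \<in> ball 0 1" for z
  proof -
    have "norm (g z) \<le> exp (K * L) / 2 ^ N" using that by (intro g_bd) simp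
    also have "\<dots> \<le> exp (K * L)" by (simp add: divide_le_eq)
    finally show ?thesis .
  qed
  have "1 < norm (g 0)" using g0 L by (smt (verit) one_less_exp_iff)
  then have g_log: "norm (deriv g z / g z) \<le> 24 * (K * L)" if "norm z \<le> 1/2" for z
    using nonvanishing_log_deriv_bound[of g "K * L" z] holomorphic_on_subset[OF g(1)] g(3) g_bd1 that by blast
  have "F z \<noteq> 0 \<and> norm (deriv F z / F z) \<le> 24 * K * L + (\<Sum>w\<in>Z. real (m w) / dist z w)"
    if z: "norm z \<le> 1/2" "z \<notin> Z" for z
  proof
    have Qz: "Q z \<noteq> 0" using z(2) Z(1) by (auto simp: Q_def)
    have gz: "g z \<noteq> 0" using z(1) g(3) by simp
    show "F z \<noteq> 0" using Qz gz by (simp add: g(2) Q_def)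
    have "(g has_field_derivative deriv g z) (at z)"
      using g(1) by (intro holomorphic_derivI) auto
    then have "((\<lambda>z. Q z * g z) has_field_derivative Q z * deriv g z + Q z * (\<Sum>w\<in>Z. of_nat (m w) / (z - w)) * g z) (at z)"
      unfolding Q_def by (intro DERIV_mult' has_field_derivative_prod_powers Z z)
    moreover have "F = (\<lambda>z. Q z * g z)" by (simp add: fun_eq_iff g(2) Q_def)
    ultimately have "deriv F z = Q z * deriv g z + Q z * (\<Sum>w\<in>Z. of_nat (m w) / (z - w)) * g z" "F z = Q z * g z"
      by (simp_all add: DERIV_imp_deriv)
    then have "deriv F z / F z = deriv g z / g z + (\<Sum>w\<in>Z. of_nat (m w) / (z - w))"
      using Qz gz by (simp add: field_simps)
    then have "norm (deriv F z / F z) \<le> norm (deriv g z / g z) + norm (\<Sum>w\<in>Z. of_nat (m w) / (z - w))"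
      using norm_triangle_ineq by metis
    also have "norm (\<Sum>w\<in>Z. of_nat (m w) / (z - w)) \<le> (\<Sum>w\<in>Z. real (m w) / dist z w)"
      by (rule order_trans[OF norm_sum]) (simp add: norm_divide dist_norm)
    finally show "norm (deriv F z / F z) \<le> 24 * K * L + (\<Sum>w\<in>Z. real (m w) / dist z w)"
      using g_log[OF z(1)] by simp
  qed
  moreover have "(\<Sum>w\<in>Z. real (m w)) \<le> 2 * K * L" using N by (simp add: N_def)
  ultimately show thesis using that[of Z m] Z by blast
qed

text \<open>Averages \<open>ln (max \<bar>F\<bar> (exp l))\<close> over a disc about \<open>0\<close> and over the same disc shifted by \<open>-e/4\<close>,
  where it is constantly \<open>l\<close>; the difference is controlled by integrating \<open>\<bar>F'/F\<bar>\<close> along the shift.\<close>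
lemma log_deriv_integral_lower_bound:
  assumes F: "F holomorphic_on UNIV" and L: "L > 0" and c: "c \<ge> 0" and F0: "exp L \<le> norm (F 0)"
    and e: "norm e = 1" and small: "\<And>z. z \<in> ball (- e / 4) (1/16) \<Longrightarrow> norm (F z) \<le> exp ((1 - c) * L)"
  shows "ennreal (pi / 64 * c * L) \<le>
    (\<integral>\<^sup>+z\<in>ball 0 (3/8) \<inter> {z. exp ((1 - c) * L) \<le> norm (F z)}. ennreal (norm (deriv F z / F z)) \<partial>lborel)"
proof -
  define l where "l = (1 - c) * L"
  define D where "D = ball (0::complex) (1/16)"
  have cont_F: "continuous_on A F" for A
    using F holomorphic_on_imp_continuous_on continuous_on_subset by blast
  have "deriv F holomorphic_on UNIV" using F by (intro holomorphic_deriv) auto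
  then have cont_dF: "continuous_on A (deriv F)" for A
    using holomorphic_on_imp_continuous_on continuous_on_subset by blast
  have [measurable]: "F \<in> borel_measurable borel" "deriv F \<in> borel_measurable borel"
    by (intro borel_measurable_continuous_onI cont_F cont_dF)+
  have [measurable]: "ball (a::complex) r \<in> sets borel" for a r by simp
  define q where "q z = ennreal (norm (deriv F z / F z)) * indicator {z. exp l \<le> norm (F z)} z" for z
  define Q where "Q z = q z * indicator (ball 0 (3/8)) z" for z
  have [measurable]: "D \<in> sets borel" by (simp add: D_def)
  have [measurable]: "q \<in> borel_measurable borel" unfolding q_def by measurable
  have [measurable]: "Q \<in> borel_measurable borel" unfolding Q_def by measurable
  have "exp 0 < norm (F 0)" using L by (intro less_le_trans[OF _ F0]) simp
  then have F0': "F 0 \<noteq> 0" by auto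
  then have lnF0: "L \<le> ln (norm (F 0))" using F0 by (simp add: ln_ge_iff)
  have "l \<le> L" using c L by (simp add: l_def mult_left_le_one_le algebra_simps)
  have step: "ennreal (ln (max (norm (F z)) (exp l)) - l) \<le> (\<integral>\<^sup>+x\<in>{0..1}. ennreal (1/4) * Q (z + of_real (x - 1) * (e / 4)) \<partial>lborel)"
    if z: "z \<in> D" for z
  proof -
    define a where "a = z - e / 4"
    have "dist (- e / 4) a < 1/16" using z by (simp add: a_def D_def dist_norm)
    then have "norm (F a) \<le> exp l" unfolding l_def by (intro small) (simp add: dist_commute)
    from ln_max_norm_increment_le[OF F this, of z]
    have "ennreal (ln (max (norm (F z)) (exp l)) - l) \<le>
      (\<integral>\<^sup>+x\<in>{0..1}. ennreal (norm (z - a) * norm (deriv F (a + of_real x * (z - a)) / F (a + of_real x * (z - a))))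
        * indicator {z. exp l \<le> norm (F z)} (a + of_real x * (z - a)) \<partial>lborel)" .
    also have "\<dots> = (\<integral>\<^sup>+x\<in>{0..1}. ennreal (1/4) * Q (z + of_real (x - 1) * (e / 4)) \<partial>lborel)"
    proof (rule nn_integral_cong)
      fix x :: real
      have p: "a + of_real x * (z - a) = z + of_real (x - 1) * (e / 4)"
        by (simp add: a_def field_simps)
      have n: "norm (z - a) = 1/4" using e by (simp add: a_def norm_divide)
      have "z + of_real (x - 1) * (e / 4) \<in> ball 0 (3/8)" if "x \<in> {0..1}"
      proof -
        have "norm (of_real (x - 1) * (e / 4)) = \<bar>x - 1\<bar> * (1/4)"
          using e by (simp only: norm_mult norm_of_real norm_divide) simp
        also have "\<dots> \<le> 1/4" using that by simp
        finally have "norm (z + of_real (x - 1) * (e / 4)) < 1/16 + 1/4"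
          using z norm_triangle_ineq[of z "of_real (x - 1) * (e / 4)"] by (simp add: D_def)
        then show ?thesis by simp
      qed
      note in_ball = this
      show "ennreal (norm (z - a) * norm (deriv F (a + of_real x * (z - a)) / F (a + of_real x * (z - a))))
        * indicator {z. exp l \<le> norm (F z)} (a + of_real x * (z - a)) * indicator {0..1} x
        = ennreal (1/4) * Q (z + of_real (x - 1) * (e / 4)) * indicator {0..1} x"
      proof (cases "x \<in> {0..1}")
        case True
        then show ?thesis
          using in_ball[OF True] unfolding p n Q_def q_def
          by (simp only: indicator_simps mult.assoc mult_1_right norm_ge_zero ennreal_mult[of "1/4"]
              zero_le_divide_1_iff zero_le_numeral)
      qed simp
    qed
    finally show ?thesis .
  qed
  have "ennreal (pi * (1/16)\<^sup>2 * (c * L)) \<le> ennreal (pi * (1/16)\<^sup>2 * (ln (norm (F 0)) - l))"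
    using lnF0 by (intro ennreal_leI mult_left_mono) (auto simp: l_def algebra_simps)
  also have "\<dots> \<le> (\<integral>\<^sup>+z\<in>D. ennreal (ln (max (norm (F z)) (exp l)) - l) \<partial>lborel)"
    unfolding D_def using lnF0 \<open>l \<le> L\<close> by (intro ln_norm_disc_submean F F0') auto
  also have "\<dots> \<le> (\<integral>\<^sup>+z. (\<integral>\<^sup>+x\<in>{0..1}. ennreal (1/4) * Q (z + of_real (x - 1) * (e / 4)) \<partial>lborel) \<partial>lborel)"
    using step by (intro nn_integral_mono) (auto simp: indicator_def)
  also have "\<dots> = (\<integral>\<^sup>+x. (\<integral>\<^sup>+z. ennreal (1/4) * Q (z + of_real (x - 1) * (e / 4)) * indicator {0..1} x \<partial>lborel) \<partial>lborel)"
    by (rule lborel_pair.Fubini') measurable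
  also have "\<dots> = (\<integral>\<^sup>+x. (ennreal (1/4) * (\<integral>\<^sup>+z. Q z \<partial>lborel)) * indicator {0..1::real} x \<partial>lborel)"
  proof (rule nn_integral_cong)
    fix x :: real
    have "(\<integral>\<^sup>+z. Q (z + of_real (x - 1) * (e / 4)) \<partial>lborel) = (\<integral>\<^sup>+z. Q z \<partial>lborel)"
      using nn_integral_lborel_translate[of Q "of_real (x - 1) * (e / 4)"] by (simp add: add.commute)
    then show "(\<integral>\<^sup>+z. ennreal (1/4) * Q (z + of_real (x - 1) * (e / 4)) * indicator {0..1} x \<partial>lborel)
      = (ennreal (1/4) * (\<integral>\<^sup>+z. Q z \<partial>lborel)) * indicator {0..1} x"
      by (simp add: nn_integral_multc nn_integral_cmult del: of_real_diff)
  qed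
  also have "\<dots> = ennreal (1/4) * (\<integral>\<^sup>+z. Q z \<partial>lborel)"
    by (subst nn_integral_cmult_indicator) simp_all
  finally have le: "ennreal (pi * (1/16)\<^sup>2 * (c * L)) \<le> ennreal (1/4) * (\<integral>\<^sup>+z. Q z \<partial>lborel)" .
  have "ennreal (pi / 64 * c * L) = ennreal 4 * ennreal (pi * (1/16)\<^sup>2 * (c * L))"
    using c L by (subst ennreal_mult[symmetric]) (auto simp: power2_eq_square)
  also have "\<dots> \<le> ennreal 4 * (ennreal (1/4) * (\<integral>\<^sup>+z. Q z \<partial>lborel))"
    by (intro mult_left_mono le) simp
  also have "\<dots> = (ennreal 4 * ennreal (1/4)) * (\<integral>\<^sup>+z. Q z \<partial>lborel)" by (simp only: mult.assoc)
  also have "ennreal 4 * ennreal (1/4) = 1" by (subst ennreal_mult[symmetric]) auto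
  finally have "ennreal (pi / 64 * c * L) \<le> (\<integral>\<^sup>+z. Q z \<partial>lborel)" by simp
  also have "\<dots> = (\<integral>\<^sup>+z\<in>ball 0 (3/8) \<inter> {z. exp l \<le> norm (F z)}. ennreal (norm (deriv F z / F z)) \<partial>lborel)"
    by (intro nn_integral_cong) (auto simp: Q_def q_def indicator_def)
  finally show ?thesis by (simp add: l_def)
qed

lemma nn_integral_sum_inverse_dist_le:
  fixes Z :: "complex set"
  assumes Z: "finite Z" and N: "(\<Sum>w\<in>Z. real (m w)) \<le> N" and s: "s > 0"
    and E [measurable]: "E \<in> sets borel" and le: "emeasure lborel E \<le> ennreal M" and M: "M \<ge> 0"
  shows "(\<integral>\<^sup>+z\<in>E. ennreal (\<Sum>w\<in>Z. real (m w) / dist z w) \<partial>lborel) \<le> ennreal (N * (4 * pi * s + M / s))"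
proof -
  have "(\<integral>\<^sup>+z\<in>E. ennreal (\<Sum>w\<in>Z. real (m w) / dist z w) \<partial>lborel)
     = (\<integral>\<^sup>+z. (\<Sum>w\<in>Z. ennreal (real (m w)) * (ennreal (1 / dist z w) * indicator E z)) \<partial>lborel)"
  proof (rule nn_integral_cong)
    fix z
    have "ennreal (\<Sum>w\<in>Z. real (m w) / dist z w) = (\<Sum>w\<in>Z. ennreal (real (m w)) * ennreal (1 / dist z w))"
      by (subst sum_ennreal[symmetric]) (auto simp: ennreal_mult[symmetric] intro!: sum.cong)
    then show "ennreal (\<Sum>w\<in>Z. real (m w) / dist z w) * indicator E z
      = (\<Sum>w\<in>Z. ennreal (real (m w)) * (ennreal (1 / dist z w) * indicator E z))"
      by (simp only: sum_distrib_right mult.assoc)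
  qed
  also have "\<dots> = (\<Sum>w\<in>Z. ennreal (real (m w)) * (\<integral>\<^sup>+z\<in>E. ennreal (1 / dist z w) \<partial>lborel))"
    by (subst nn_integral_sum) (auto simp: nn_integral_cmult)
  also have "\<dots> \<le> (\<Sum>w\<in>Z. ennreal (real (m w)) * ennreal (4 * pi * s + M / s))"
    by (intro sum_mono mult_left_mono nn_integral_inverse_dist_le s E le M) simp
  also have "\<dots> = ennreal ((\<Sum>w\<in>Z. real (m w)) * (4 * pi * s + M / s))"
  proof -
    have "(\<Sum>w\<in>Z. ennreal (real (m w)) * ennreal (4 * pi * s + M / s)) = (\<Sum>w\<in>Z. ennreal (real (m w) * (4 * pi * s + M / s)))"
      using s M by (intro sum.cong ennreal_mult[symmetric]) auto
    also have "\<dots> = ennreal (\<Sum>w\<in>Z. real (m w) * (4 * pi * s + M / s))"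
      using s M by (intro sum_ennreal) auto
    finally show ?thesis by (simp only: sum_distrib_right)
  qed
  also have "\<dots> \<le> ennreal (N * (4 * pi * s + M / s))"
    using s M by (intro ennreal_leI mult_right_mono N) auto
  finally show ?thesis .
qed

lemma good_set_large:
  fixes K c L lam :: real
  assumes F: "F holomorphic_on UNIV" and L: "L > 0" and F0: "exp L \<le> norm (F 0)"
    and bd: "\<And>z. norm z \<le> 3 \<Longrightarrow> norm (F z) \<le> exp (K * L)"
    and K: "K \<ge> 1" and c: "c > 0" and e: "norm e = 1"
    and small: "\<And>z. z \<in> ball (- e / 4) (1/16) \<Longrightarrow> norm (F z) \<le> exp ((1 - c) * L)"
    and \<beta>: "\<beta> = pi / 64 * c" and s: "s = \<beta> / (64 * pi * K)" and e0: "e0 = \<beta> / (4 * (24 * K + 2 * K / s))"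
    and a: "a = 136 * K / e0"
    and lam: "lam \<ge> 0" "8 * lam \<le> L" "32 * pi * K * lam\<^sup>2 \<le> e0 * L"
  obtains G where "G \<in> sets borel" "G \<subseteq> ball 0 (3/8)" "ennreal (e0 / 2) \<le> emeasure lborel G"
    "\<And>z. z \<in> G \<Longrightarrow> exp ((1 - c) * L) \<le> norm (F z)"
    "\<And>z. z \<in> G \<Longrightarrow> \<beta> / 4 * L \<le> norm (deriv F z / F z)"
    "\<And>z w. z \<in> G \<Longrightarrow> dist w z \<le> lam / L \<Longrightarrow> norm w \<le> 1/2 \<and> F w \<noteq> 0 \<and> norm (deriv F w / F w) \<le> (24 * K + 2 * a) * L"
proof -
  have \<beta>0: "\<beta> > 0" using c by (simp add: \<beta>)
  have s0: "s > 0" using \<beta>0 K by (simp add: s)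
  have k0: "24 * K + 2 * K / s > 0" using K s0 by (intro add_pos_pos) auto
  have e00: "e0 > 0" unfolding e0 using \<beta>0 k0 by (intro divide_pos_pos) auto
  have a0: "a > 0" unfolding a using e00 K by simp
  obtain Z :: "complex set" and m where Z: "finite Z" "\<And>w. w \<in> Z \<Longrightarrow> F w = 0" "\<And>w. w \<in> Z \<Longrightarrow> m w > 0"
    and N: "(\<Sum>w\<in>Z. real (m w)) \<le> 2 * K * L"
    and ld: "\<And>z. norm z \<le> 1/2 \<Longrightarrow> z \<notin> Z \<Longrightarrow>
      F z \<noteq> 0 \<and> norm (deriv F z / F z) \<le> 24 * K * L + (\<Sum>w\<in>Z. real (m w) / dist z w)"
    by (rule log_deriv_zeros_bound[OF F L F0 bd]) blast+
  define \<sigma> where "\<sigma> z = (\<Sum>w\<in>Z. real (m w) / dist z w)" for z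
  define S where "S = {z. exp ((1 - c) * L) \<le> norm (F z)}"
  define \<Omega> where "\<Omega> = ball (0::complex) (3/8)"
  define q where "q z = norm (deriv F z / F z)" for z
  define E1 where "E1 = {z \<in> \<Omega>. a * L \<le> \<sigma> z}"
  define E2 where "E2 = (\<Union>w\<in>Z. cball w (2 * lam / L))"
  define G where "G = {z \<in> \<Omega> \<inter> S. \<beta> / 4 * L \<le> q z} - E1 - E2"
  have cont_F: "continuous_on A F" for A
    using F holomorphic_on_imp_continuous_on continuous_on_subset by blast
  have "deriv F holomorphic_on UNIV" using F by (intro holomorphic_deriv) auto
  then have cont_dF: "continuous_on A (deriv F)" for A
    using holomorphic_on_imp_continuous_on continuous_on_subset by blast
  have [measurable]: "F \<in> borel_measurable borel" "deriv F \<in> borel_measurable borel"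
    by (intro borel_measurable_continuous_onI cont_F cont_dF)+
  have [measurable]: "q \<in> borel_measurable borel" "\<sigma> \<in> borel_measurable borel"
    unfolding q_def \<sigma>_def by measurable
  have [measurable]: "\<Omega> \<in> sets borel" "E2 \<in> sets borel"
    unfolding \<Omega>_def E2_def using Z(1) by (auto intro!: sets.finite_UN)
  have [measurable]: "S \<in> sets borel" "E1 \<in> sets borel"
    unfolding S_def E1_def by measurable
  have [measurable]: "G \<in> sets borel" unfolding G_def by measurable
  have \<Omega>1: "emeasure lborel \<Omega> \<le> ennreal 1"
    unfolding \<Omega>_def using pi_less_4 by (subst emeasure_lborel_disc) (auto simp: power2_eq_square intro!: ennreal_leI)
  have E1: "emeasure lborel E1 \<le> ennreal (e0 / 4)"
  proof -
    have "ennreal (a * L) * emeasure lborel E1 = (\<integral>\<^sup>+z. ennreal (a * L) * indicator E1 z \<partial>lborel)"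
      by (simp add: nn_integral_cmult_indicator)
    also have "\<dots> \<le> (\<integral>\<^sup>+z\<in>\<Omega>. ennreal (\<sigma> z) \<partial>lborel)"
      by (intro nn_integral_mono) (auto simp: E1_def indicator_def intro!: ennreal_leI)
    also have "\<dots> \<le> ennreal (2 * K * L * (4 * pi * 1 + 1 / 1))"
      unfolding \<sigma>_def using Z(1) N by (intro nn_integral_sum_inverse_dist_le \<Omega>1) auto
    also have "\<dots> \<le> ennreal (34 * K * L)"
    proof (rule ennreal_leI)
      have "2 * K * L * (4 * pi + 1) \<le> 2 * K * L * 17"
        using pi_less_4 K L by (intro mult_left_mono) auto
      then show "2 * K * L * (4 * pi * 1 + 1 / 1) \<le> 34 * K * L" by simp
    qed
    also have "34 * K * L = a * L * (e0 / 4)" using e00 by (simp add: a field_simps)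
    also have "ennreal (a * L * (e0 / 4)) = ennreal (a * L) * ennreal (e0 / 4)"
      using a0 L e00 by (intro ennreal_mult) auto
    finally show ?thesis
      using a0 L by (simp add: ennreal_mult_le_mult_iff)
  qed
  have E2: "emeasure lborel E2 \<le> ennreal (e0 / 4)"
  proof -
    have "emeasure lborel E2 \<le> (\<Sum>w\<in>Z. emeasure lborel (cball w (2 * lam / L)))"
      unfolding E2_def using Z(1) by (intro emeasure_subadditive_finite) auto
    also have "\<dots> = (\<Sum>w\<in>Z. ennreal (pi * (2 * lam / L)\<^sup>2))"
      using lam L by (intro sum.cong) (auto simp: emeasure_cball unit_ball_vol_2 power2_eq_square)
    also have "\<dots> = ennreal (real (card Z) * (pi * (2 * lam / L)\<^sup>2))"
      by (simp add: ennreal_mult ennreal_of_nat_eq_real_of_nat)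
    also have "\<dots> \<le> ennreal (e0 / 4)"
    proof (rule ennreal_leI)
      have "real (card Z) = (\<Sum>w\<in>Z. 1)" by simp
      also have "\<dots> \<le> (\<Sum>w\<in>Z. real (m w))"
        using Z(3) by (intro sum_mono) (simp add: Suc_leI)
      finally have "real (card Z) * (pi * (2 * lam / L)\<^sup>2) \<le> 2 * K * L * (pi * (2 * lam / L)\<^sup>2)"
        using N by (intro mult_right_mono) auto
      also have "\<dots> = (32 * pi * K * lam\<^sup>2) / (4 * L)"
        using L by (simp add: power2_eq_square field_simps)
      also have "\<dots> \<le> (e0 * L) / (4 * L)"
        using lam(3) L by (intro divide_right_mono) auto
      also have "\<dots> = e0 / 4" using L by simp
      finally show "real (card Z) * (pi * (2 * lam / L)\<^sup>2) \<le> e0 / 4" .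
    qed
    finally show ?thesis .
  qed
  have large: "ennreal (e0 / 2) \<le> emeasure lborel G"
  proof (rule ccontr)
    assume "\<not> ?thesis"
    then have G: "emeasure lborel G \<le> ennreal (e0 / 2)" by simp
    define B where "B = E1 \<union> E2 \<union> G"
    have [measurable]: "B \<in> sets borel" by (simp add: B_def)
    have "emeasure lborel B \<le> emeasure lborel (E1 \<union> E2) + emeasure lborel G"
      unfolding B_def by (intro emeasure_subadditive) auto
    also have "\<dots> \<le> (emeasure lborel E1 + emeasure lborel E2) + emeasure lborel G"
      by (intro add_right_mono emeasure_subadditive) auto
    also have "\<dots> \<le> (ennreal (e0 / 4) + ennreal (e0 / 4)) + ennreal (e0 / 2)"
      by (intro add_mono E1 E2 G)
    also have "\<dots> = ennreal e0" using e00 by (simp flip: ennreal_plus)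
    finally have B: "emeasure lborel B \<le> ennreal e0" .
    have "ennreal (\<beta> * L) \<le> (\<integral>\<^sup>+z\<in>\<Omega> \<inter> S. ennreal (q z) \<partial>lborel)"
      unfolding \<Omega>_def S_def q_def \<beta> by (rule log_deriv_integral_lower_bound[OF F L less_imp_le[OF c] F0 e small])
    also have "\<dots> \<le> (\<integral>\<^sup>+z. ennreal (\<beta> / 4 * L) * indicator \<Omega> z + (ennreal (24 * K * L) * indicator B z + ennreal (\<sigma> z) * indicator B z) \<partial>lborel)"
    proof (rule nn_integral_mono)
      fix z
      show "ennreal (q z) * indicator (\<Omega> \<inter> S) z \<le> ennreal (\<beta> / 4 * L) * indicator \<Omega> z + (ennreal (24 * K * L) * indicator B z + ennreal (\<sigma> z) * indicator B z)"
      proof (cases "z \<in> \<Omega> \<inter> S")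
        case z: True
        show ?thesis
        proof (cases "\<beta> / 4 * L \<le> q z")
          case True
          then have "z \<in> B" using z by (auto simp: B_def G_def)
          have "0 < exp ((1 - c) * L)" by simp
          also have "\<dots> \<le> norm (F z)" using z by (simp add: S_def)
          finally have "z \<notin> Z" using Z(2) by auto
          moreover have "norm z \<le> 1/2" using z by (simp add: \<Omega>_def)
          ultimately have "q z \<le> 24 * K * L + \<sigma> z" using ld by (simp add: q_def \<sigma>_def)
          then have "ennreal (q z) \<le> ennreal (24 * K * L + \<sigma> z)" by (rule ennreal_leI)
          also have "\<dots> = ennreal (24 * K * L) + ennreal (\<sigma> z)"
            using K L by (intro ennreal_plus) (auto simp: \<sigma>_def sum_nonneg)
          finally have "ennreal (q z) \<le> ennreal (24 * K * L) + ennreal (\<sigma> z)" .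
          then show ?thesis using z \<open>z \<in> B\<close> by (simp add: add_increasing)
        next
          case False
          then have "ennreal (q z) \<le> ennreal (\<beta> / 4 * L)" by (intro ennreal_leI) simp
          then show ?thesis using z by (simp add: add_increasing2)
        qed
      qed simp
    qed
    also have "\<dots> = ennreal (\<beta> / 4 * L) * emeasure lborel \<Omega> + (ennreal (24 * K * L) * emeasure lborel B + (\<integral>\<^sup>+z\<in>B. ennreal (\<sigma> z) \<partial>lborel))"
      by (simp add: nn_integral_add nn_integral_cmult_indicator)
    also have "\<dots> \<le> ennreal (\<beta> / 4 * L) * ennreal 1 + (ennreal (24 * K * L) * ennreal e0 + ennreal (2 * K * L * (4 * pi * s + e0 / s)))"
      unfolding \<sigma>_def using Z(1) N s0 e00
      by (intro add_mono mult_left_mono \<Omega>1 B nn_integral_sum_inverse_dist_le) auto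
    also have "\<dots> = ennreal (\<beta> / 4 * L * 1 + (24 * K * L * e0 + 2 * K * L * (4 * pi * s + e0 / s)))"
      using \<beta>0 L K e00 s0 by (simp add: ennreal_mult[symmetric] del: ennreal_plus flip: ennreal_plus)
    finally have "\<beta> * L \<le> \<beta> / 4 * L * 1 + (24 * K * L * e0 + 2 * K * L * (4 * pi * s + e0 / s))"
      using \<beta>0 L K e00 s0 by (subst (asm) ennreal_le_iff) auto
    also have "\<dots> = (\<beta> / 4 + (24 * K + 2 * K / s) * e0 + 8 * pi * K * s) * L"
      by (simp add: algebra_simps)
    also have "(24 * K + 2 * K / s) * e0 = \<beta> / 4"
    proof -
      have "k * (\<beta> / (4 * k)) = \<beta> / 4" if "k > 0" for k using that by simp
      from this[OF k0] show ?thesis by (simp only: e0)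
    qed
    also have "8 * pi * K * s = \<beta> / 8" using K by (simp add: s field_simps)
    finally have "\<beta> * L \<le> (5 / 8 * \<beta>) * L" by simp
    then show False using \<beta>0 L by simp
  qed
  show thesis
  proof (rule that[of G])
    show "G \<subseteq> ball 0 (3/8)" by (auto simp: G_def \<Omega>_def)
    fix z assume z: "z \<in> G"
    show "exp ((1 - c) * L) \<le> norm (F z)" "\<beta> / 4 * L \<le> norm (deriv F z / F z)"
      using z by (auto simp: G_def S_def q_def)
    fix w assume w: "dist w z \<le> lam / L"
    have "lam / L \<le> 1/8" using lam(2) L by (simp add: field_simps)
    moreover have "norm z < 3/8" using z by (simp add: G_def \<Omega>_def)
    ultimately have nw: "norm w \<le> 1/2"
      using w norm_triangle_sub[of w z] unfolding dist_norm by linarith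
    have d: "dist z v \<le> 2 * dist w v" "dist w v > 0" if "v \<in> Z" for v
    proof -
      have "2 * lam / L < dist z v"
        using z that by (auto simp: G_def E2_def dist_commute not_le)
      then have "2 * (lam / L) < dist z v" "0 \<le> lam / L" using lam L by simp_all
      moreover have "dist z v \<le> dist w z + dist w v" by (metis dist_commute dist_triangle)
      ultimately show "dist z v \<le> 2 * dist w v" "dist w v > 0" using w by linarith+
    qed
    then have "w \<notin> Z" using d(2)[of w] by auto
    have "0 < exp ((1 - c) * L)" by simp
    also have "\<dots> \<le> norm (F z)" using z by (simp add: G_def S_def)
    finally have "z \<notin> Z" using Z(2) by auto
    have "(\<Sum>v\<in>Z. real (m v) / dist w v) \<le> (\<Sum>v\<in>Z. 2 * (real (m v) / dist z v))"
    proof (rule sum_mono)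
      fix v assume v: "v \<in> Z"
      have "z \<noteq> v" using v \<open>z \<notin> Z\<close> by blast
      then have "dist z v > 0" by simp
      then show "real (m v) / dist w v \<le> 2 * (real (m v) / dist z v)"
        using d[OF v] by (simp add: field_simps mult_left_mono)
    qed
    also have "\<dots> = 2 * \<sigma> z" by (simp add: \<sigma>_def sum_distrib_left)
    also have "\<sigma> z \<le> a * L" using z by (auto simp: G_def E1_def)
    finally have "(\<Sum>v\<in>Z. real (m v) / dist w v) \<le> 2 * (a * L)" by simp
    then show "norm w \<le> 1/2 \<and> F w \<noteq> 0 \<and> norm (deriv F w / F w) \<le> (24 * K + 2 * a) * L"
      using nw ld[OF nw \<open>w \<notin> Z\<close>] by (auto simp: algebra_simps)
  qed (use large in auto)
qed

section \<open>The maximum modulus\<close>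

lemma maxmod_attained:
  assumes f: "continuous_on UNIV f" and r: "r \<ge> 0"
  obtains z where "norm z = r" "norm (f z) = maxmod f r" "\<And>w. norm w = r \<Longrightarrow> norm (f w) \<le> maxmod f r"
proof -
  have "continuous_on (sphere 0 r) (\<lambda>z. norm (f z))"
    by (intro continuous_on_norm continuous_on_subset[OF f]) auto
  moreover have "sphere (0::complex) r \<noteq> {}" using r by simp
  ultimately obtain z where z: "z \<in> sphere 0 r" "\<And>w. w \<in> sphere 0 r \<Longrightarrow> norm (f w) \<le> norm (f z)"
    using continuous_attains_sup[OF compact_sphere] by blast
  then have "maxmod f r = norm (f z)"
    unfolding maxmod_def by (intro cSup_eq_maximum) auto
  then show thesis using that[of z] z by auto
qed

lemma norm_le_maxmod:
  assumes "continuous_on UNIV f"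
  shows "norm (f z) \<le> maxmod f (norm z)"
  using maxmod_attained[OF assms norm_ge_zero[of z]] by metis

lemma maxmod_mono:
  assumes f: "f holomorphic_on UNIV" and rs: "0 \<le> r" "r \<le> s"
  shows "maxmod f r \<le> maxmod f s"
proof -
  have cont: "continuous_on UNIV f" using f by (rule holomorphic_on_imp_continuous_on)
  obtain z where z: "norm z = r" "norm (f z) = maxmod f r"
    using maxmod_attained[OF cont rs(1)] by metis
  have "norm (f z) \<le> maxmod f s"
  proof (rule maximum_modulus_frontier[of f "cball 0 s"])
    show "f holomorphic_on interior (cball 0 s)" "continuous_on (closure (cball 0 s)) f"
      using f cont by (auto intro: holomorphic_on_subset continuous_on_subset)
    fix w :: complex assume "w \<in> frontier (cball 0 s)"
    then have "norm w = s" by simp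
    then show "norm (f w) \<le> maxmod f s" using norm_le_maxmod[OF cont, of w] by simp
  qed (use z rs in auto)
  then show ?thesis using z by simp
qed

lemma continuous_maxmod_norm:
  assumes f: "continuous_on UNIV f"
  shows "continuous_on UNIV (\<lambda>z::complex. maxmod f (norm z))"
  unfolding continuous_on_iff
proof (intro ballI allI impI)
  fix z0 :: complex and \<epsilon> :: real assume \<epsilon>: "\<epsilon> > 0"
  define b where "b = norm z0 + 1"
  have "uniformly_continuous_on (cball 0 b) f"
    by (intro compact_uniformly_continuous continuous_on_subset[OF f]) auto
  then obtain \<delta> where \<delta>: "\<delta> > 0" "\<And>x y. x \<in> cball 0 b \<Longrightarrow> y \<in> cball 0 b \<Longrightarrow> dist y x < \<delta> \<Longrightarrow> dist (f y) (f x) < \<epsilon>"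
    unfolding uniformly_continuous_on_def using \<epsilon> by metis
  have key: "maxmod f r < maxmod f s + \<epsilon>" if rs: "0 \<le> r" "r \<le> b" "0 \<le> s" "s \<le> b" "\<bar>r - s\<bar> < \<delta>" for r s
  proof -
    obtain z where z: "norm z = r" "norm (f z) = maxmod f r"
      using maxmod_attained[OF f rs(1)] by metis
    obtain u where u: "norm u = 1" "z = of_real r * u"
    proof (cases "z = 0")
      case True
      then show ?thesis using z that[of 1] by simp
    next
      case False
      then show ?thesis using z that[of "z / of_real r"] by (auto simp: norm_divide)
    qed
    define w where "w = of_real s * u"
    have w: "norm w = s" using u rs by (simp add: w_def norm_mult)
    have "z - w = of_real (r - s) * u" by (simp add: u(2) w_def left_diff_distrib)
    then have "dist z w = \<bar>r - s\<bar>" by (simp only: dist_norm norm_mult norm_of_real u(1) mult_1_right)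
    then have "dist (f z) (f w) < \<epsilon>" using rs z w by (intro \<delta>) auto
    then have "norm (f z) < norm (f w) + \<epsilon>"
      using norm_triangle_sub[of "f z" "f w"] by (simp add: dist_norm)
    then show ?thesis using norm_le_maxmod[OF f, of w] z w by simp
  qed
  show "\<exists>d>0. \<forall>z\<in>UNIV. dist z z0 < d \<longrightarrow> dist (maxmod f (norm z)) (maxmod f (norm z0)) < \<epsilon>"
  proof (intro exI[of _ "min \<delta> 1"] conjI ballI impI)
    fix z assume "dist z z0 < min \<delta> 1"
    then have "\<bar>norm z - norm z0\<bar> < \<delta>" "\<bar>norm z - norm z0\<bar> < 1"
      using norm_triangle_ineq3[of z z0] by (auto simp: dist_norm)
    then have "maxmod f (norm z) < maxmod f (norm z0) + \<epsilon>" "maxmod f (norm z0) < maxmod f (norm z) + \<epsilon>"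
      by (auto intro!: key simp: b_def)
    then show "dist (maxmod f (norm z)) (maxmod f (norm z0)) < \<epsilon>" by (simp add: dist_real_def)
  qed (use \<delta> in auto)
qed

lemma borel_near_open:
  fixes U :: "'a::euclidean_space set"
  assumes U: "open U" and [measurable]: "\<rho> \<in> borel_measurable borel"
  shows "{z. \<exists>w\<in>U. dist w z \<le> \<rho> z} \<in> sets borel"
proof (cases "U = {}")
  case False
  have "(\<exists>w\<in>U. dist w z \<le> \<rho> z) \<longleftrightarrow> infdist z U < \<rho> z \<or> (z \<in> U \<and> 0 \<le> \<rho> z)" for z
  proof
    assume "\<exists>w\<in>U. dist w z \<le> \<rho> z"
    then obtain w where w: "w \<in> U" "dist w z \<le> \<rho> z" by blast
    show "infdist z U < \<rho> z \<or> (z \<in> U \<and> 0 \<le> \<rho> z)"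
    proof (cases "w = z")
      case False
      then have d: "dist w z > 0" by simp
      obtain e where e: "e > 0" "ball w e \<subseteq> U" using U w(1) by (rule openE)
      define t where "t = min 1 (e / (2 * dist w z))"
      have t: "0 < t" "t \<le> 1" using d e by (auto simp: t_def)
      define w' where "w' = w + t *\<^sub>R (z - w)"
      have "dist w w' = t * dist w z"
        using t by (simp add: w'_def dist_norm norm_minus_commute)
      also have "\<dots> \<le> e / (2 * dist w z) * dist w z"
        by (intro mult_right_mono) (simp_all add: t_def)
      also have "\<dots> < e" using d e by simp
      finally have "w' \<in> U" using e(2) by auto
      have "z - w' = (1 - t) *\<^sub>R (z - w)" by (simp add: w'_def algebra_simps)
      then have "dist z w' = (1 - t) * dist w z" using t by (simp add: dist_norm norm_minus_commute)
      also have "\<dots> < 1 * dist w z" using t d by (intro mult_strict_right_mono) auto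
      finally have "infdist z U < \<rho> z"
        using infdist_le[OF \<open>w' \<in> U\<close>, of z] w(2) by simp
      then show ?thesis by simp
    qed (use w in auto)
  next
    assume *: "infdist z U < \<rho> z \<or> (z \<in> U \<and> 0 \<le> \<rho> z)"
    show "\<exists>w\<in>U. dist w z \<le> \<rho> z"
    proof (cases "infdist z U < \<rho> z")
      case True
      then have "(INF w\<in>U. dist z w) < \<rho> z" using False by (simp add: infdist_def)
      moreover have "bdd_below (dist z ` U)" by (rule bdd_belowI2[of _ 0]) simp
      ultimately obtain w where "w \<in> U" "dist z w < \<rho> z"
        using False cINF_less_iff[of U "dist z" "\<rho> z"] by auto
      then show ?thesis by (intro bexI[of _ w]) (simp_all add: dist_commute)
    qed (use * in \<open>auto intro: bexI[of _ z]\<close>)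
  qed
  then have "{z. \<exists>w\<in>U. dist w z \<le> \<rho> z} = {z. infdist z U < \<rho> z} \<union> (U \<inter> {z. 0 \<le> \<rho> z})" by auto
  moreover have [measurable]: "(\<lambda>z. infdist z U) \<in> borel_measurable borel" "U \<in> sets borel"
    using U by (auto intro!: borel_measurable_continuous_onI continuous_intros)
  moreover have "{z. infdist z U < \<rho> z} \<union> (U \<inter> {z. 0 \<le> \<rho> z}) \<in> sets borel" by measurable
  ultimately show ?thesis by simp
qed simp

lemma borel_near_closed:
  fixes S :: "'a::euclidean_space set"
  assumes S: "closed S" and [measurable]: "\<rho> \<in> borel_measurable borel"
  shows "{z. \<exists>w\<in>S. dist w z \<le> \<rho> z} \<in> sets borel"
proof (cases "S = {}")
  case False
  have "(\<exists>w\<in>S. dist w z \<le> \<rho> z) \<longleftrightarrow> infdist z S \<le> \<rho> z" for z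
    using infdist_attains_inf[OF S False, of z] infdist_le2[of _ S z] by (metis dist_commute)
  moreover have [measurable]: "(\<lambda>z. infdist z S) \<in> borel_measurable borel"
    by (auto intro!: borel_measurable_continuous_onI continuous_intros)
  moreover have "{z. infdist z S \<le> \<rho> z} \<in> sets borel" by measurable
  ultimately show ?thesis by simp
qed simp

lemma Tset_Int_annulus_borel:
  assumes f: "f holomorphic_on UNIV" and lam: "lam \<ge> 0" and R: "R > 0"
    and pos: "\<And>r. r > R / 4 \<Longrightarrow> maxmod f r > 0" and large: "\<And>r. r \<ge> R \<Longrightarrow> ln (maxmod f r) > 0 \<and> 2 * lam \<le> ln (maxmod f r)"
  shows "Tset f a1 a2 q lam \<inter> annulus R \<in> sets borel"
proof -
  have cont_f: "continuous_on A f" for A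
    using f holomorphic_on_imp_continuous_on continuous_on_subset by blast
  have "deriv f holomorphic_on UNIV" using f by (intro holomorphic_deriv) auto
  then have cont_df: "continuous_on A (deriv f)" for A
    using holomorphic_on_imp_continuous_on continuous_on_subset by blast
  have cont_M: "continuous_on A (\<lambda>z::complex. maxmod f (norm z))" for A
    using continuous_maxmod_norm[OF cont_f] continuous_on_subset by blast
  define \<rho> where "\<rho> z = lam * norm z / ln (maxmod f (norm z))" for z :: complex
  have [measurable]: "f \<in> borel_measurable borel" "deriv f \<in> borel_measurable borel"
    "(\<lambda>z::complex. maxmod f (norm z)) \<in> borel_measurable borel"
    by (intro borel_measurable_continuous_onI cont_f cont_df cont_M)+
  have \<rho>_borel: "\<rho> \<in> borel_measurable borel" unfolding \<rho>_def by measurable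
  define U where "U = {w. R / 4 < norm w \<and> f w \<noteq> 0} \<inter> {w. R / 4 < norm w \<and> f w \<noteq> 0 \<and>
    a2 * ln (maxmod f (norm w)) < norm (w * deriv f w / f w)}"
  have "open U"
  proof -
    let ?V = "{w. R / 4 < norm w \<and> f w \<noteq> 0}"
    have V: "open ?V"
    proof (intro open_Collect_conj open_Collect_less continuous_intros)
      have "closed (f -` {0})" by (intro closed_vimage cont_f) auto
      then show "open {w. f w \<noteq> 0}" by (simp add: open_closed vimage_def Compl_eq)
    qed
    have "continuous_on ?V (\<lambda>w. norm (w * deriv f w / f w) - a2 * ln (maxmod f (norm w)))"
      using pos by (intro continuous_intros cont_f cont_df cont_M) (auto simp: less_imp_neq[THEN not_sym])
    then have "open (?V \<inter> (\<lambda>w. norm (w * deriv f w / f w) - a2 * ln (maxmod f (norm w))) -` {0<..})"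
      using V by (rule continuous_open_preimage) simp
    moreover have "?V \<inter> (\<lambda>w. norm (w * deriv f w / f w) - a2 * ln (maxmod f (norm w))) -` {0<..} = U"
      by (auto simp: U_def)
    ultimately show ?thesis by simp
  qed
  have "closed {w. f w = 0}"
    by (intro closed_Collect_eq cont_f continuous_intros)
  have near: "R / 4 < norm w" if "z \<in> annulus R" "dist w z \<le> \<rho> z" for w z
  proof -
    have z: "R \<le> norm z" using that by (simp add: annulus_def)
    have "\<rho> z \<le> norm z / 2"
    proof -
      have "norm z * (2 * lam) \<le> norm z * ln (maxmod f (norm z))"
        using large[OF z] by (intro mult_left_mono) auto
      then show ?thesis using large[OF z] by (simp add: \<rho>_def field_simps)
    qed
    then have "norm z \<le> norm w + norm z / 2"
      using that(2) norm_triangle_sub[of z w] by (simp add: dist_norm norm_minus_commute)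
    then show ?thesis using z R by simp
  qed
  have "Tset f a1 a2 q lam \<inter> annulus R = {z. R \<le> norm z \<and> norm z \<le> 2 * R \<and>
     a1 * ln (maxmod f (norm z)) \<le> norm (z * deriv f z / f z) \<and>
     norm (z * deriv f z / f z) \<le> a2 * ln (maxmod f (norm z)) \<and> norm z powr q \<le> norm (f z)}
     - {z. \<exists>w\<in>{w. f w = 0}. dist w z \<le> \<rho> z} - {z. \<exists>w\<in>U. dist w z \<le> \<rho> z}" (is "_ = ?P - ?Z - ?U")
  proof (intro equalityI subsetI)
    fix z assume z: "z \<in> Tset f a1 a2 q lam \<inter> annulus R"
    then have *: "f w \<noteq> 0 \<and> norm (w * deriv f w / f w) \<le> a2 * ln (maxmod f (norm w))" if "dist w z \<le> \<rho> z" for w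
      using that by (simp add: Tset_def \<rho>_def)
    have "z \<in> ?P" using z by (simp add: Tset_def annulus_def)
    moreover have "z \<notin> ?Z" using * by blast
    moreover have "w \<notin> U" if "dist w z \<le> \<rho> z" for w
      using *[OF that] by (simp add: U_def)
    then have "z \<notin> ?U" by blast
    ultimately show "z \<in> ?P - ?Z - ?U" by blast
  next
    fix z assume z: "z \<in> ?P - ?Z - ?U"
    then have an: "z \<in> annulus R" by (simp add: annulus_def)
    have "f w \<noteq> 0 \<and> norm (w * deriv f w / f w) \<le> a2 * ln (maxmod f (norm w))" if w: "dist w z \<le> \<rho> z" for w
    proof -
      have "w \<notin> {w. f w = 0}" "w \<notin> U" using z w by blast+
      then show ?thesis using near[OF an w] by (simp add: U_def not_less)
    qed
    then show "z \<in> Tset f a1 a2 q lam \<inter> annulus R"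
      using z an by (simp add: Tset_def \<rho>_def)
  qed
  moreover have "?P \<in> sets borel" by measurable
  moreover have "?Z \<in> sets borel" using \<open>closed {w. f w = 0}\<close> \<rho>_borel by (rule borel_near_closed)
  moreover have "?U \<in> sets borel" using \<open>open U\<close> \<rho>_borel by (rule borel_near_open)
  ultimately show ?thesis by (simp only: sets.Diff)
qed

section \<open>Functions of regular growth\<close>

lemma emeasure_affine_image:
  fixes z0 :: complex
  assumes G: "G \<in> sets borel" and R: "R > 0"
  shows "(\<lambda>z. (z - z0) / of_real R) -` G \<in> sets borel"
    and "emeasure lborel ((\<lambda>z. (z - z0) / of_real R) -` G) = ennreal (R\<^sup>2) * emeasure lborel G"
proof -
  have [measurable]: "G \<in> sets borel" by fact
  have [measurable]: "(\<lambda>z. (z - z0) / of_real R) \<in> borel \<rightarrow>\<^sub>M borel" "(\<lambda>\<zeta>. z0 + R *\<^sub>R \<zeta>) \<in> borel \<rightarrow>\<^sub>M borel"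
    using R by (auto intro!: borel_measurable_continuous_onI continuous_intros)
  show meas: "(\<lambda>z. (z - z0) / of_real R) -` G \<in> sets borel"
    using measurable_sets[of "\<lambda>z. (z - z0) / of_real R" borel borel G] by simp
  have eq: "(\<lambda>\<zeta>. z0 + R *\<^sub>R \<zeta>) -` ((\<lambda>z. (z - z0) / of_real R) -` G) = G"
    using R by (auto simp: scaleR_conv_of_real)
  show "emeasure lborel ((\<lambda>z. (z - z0) / of_real R) -` G) = ennreal (R\<^sup>2) * emeasure lborel G"
    using R meas by (subst lborel_affine[of R z0])
      (simp_all add: emeasure_density nn_integral_cmult_indicator emeasure_distr eq)
qed

locale regular_growth =
  fixes f :: "complex \<Rightarrow> complex" and A B C r0 :: real
  assumes entire: "f holomorphic_on UNIV"
    and nonconst: "\<not> (\<exists>c. \<forall>z. f z = c)"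
    and A: "A > 1" and B: "B > 1" and C: "C > 1" and r0: "r0 > 1"
    and growth: "\<And>r. r \<ge> r0 \<Longrightarrow> A * ln (maxmod f r) \<le> ln (maxmod f (C * r)) \<and>
                          ln (maxmod f (C * r)) \<le> B * ln (maxmod f r)"
begin

definition L :: "real \<Rightarrow> real" where "L r = ln (maxmod f r)"

lemma continuous_f: "continuous_on UNIV f"
  using entire by (rule holomorphic_on_imp_continuous_on)

lemma L_eventually_pos: "\<exists>r1\<ge>r0. L r1 > 0 \<and> (\<forall>r\<ge>r1. maxmod f r > 1)"
proof -
  have "\<exists>r\<ge>r0. maxmod f r > 1"
  proof (rule ccontr)
    assume "\<not> ?thesis"
    then have *: "maxmod f r \<le> 1" if "r \<ge> r0" for r using that by (meson not_le)
    have "norm (f z) \<le> 1" for z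
    proof -
      have "norm (f z) \<le> maxmod f (norm z)" by (rule norm_le_maxmod[OF continuous_f])
      also have "\<dots> \<le> maxmod f (max r0 (norm z))" by (intro maxmod_mono[OF entire]) auto
      also have "\<dots> \<le> 1" by (intro *) simp
      finally show ?thesis .
    qed
    then have "bounded (range f)" by (auto simp: bounded_iff)
    then show False using nonconst Liouville_theorem[OF entire] unfolding constant_on_def by blast
  qed
  then obtain r1 where r1: "r1 \<ge> r0" "maxmod f r1 > 1" by blast
  have "maxmod f r > 1" if "r \<ge> r1" for r
    using maxmod_mono[OF entire, of r1 r] r1 r0 that by linarith
  then show ?thesis using r1 by (intro exI[of _ r1]) (simp add: L_def ln_gt_zero)
qed

definition r1 where "r1 = (SOME r1. r1 \<ge> r0 \<and> L r1 > 0 \<and> (\<forall>r\<ge>r1. maxmod f r > 1))"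

lemma r1: "r1 \<ge> r0" "L r1 > 0" "r \<ge> r1 \<Longrightarrow> maxmod f r > 1"
  using someI_ex[OF L_eventually_pos] by (auto simp: r1_def)

lemma r1_gt1: "r1 > 1" using r1(1) r0 by linarith

lemma maxmod_eq: "r \<ge> r1 \<Longrightarrow> maxmod f r = exp (L r)"
  using r1(3)[of r] by (simp add: L_def)

lemma L_mono: "r1 \<le> r \<Longrightarrow> r \<le> s \<Longrightarrow> L r \<le> L s"
  unfolding L_def using r1(3)[of r] r1_gt1 by (intro ln_mono maxmod_mono[OF entire]) auto

lemma L_pos: "r1 \<le> r \<Longrightarrow> L r > 0"
  using L_mono[of r1 r] r1(2) by simp

lemma L_C_power: "r \<ge> r1 \<Longrightarrow> A ^ n * L r \<le> L (C ^ n * r) \<and> L (C ^ n * r) \<le> B ^ n * L r"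
proof (induction n)
  case (Suc n)
  have "1 * r \<le> C ^ n * r" using C r1_gt1 Suc.prems by (intro mult_right_mono one_le_power) auto
  then have g: "A * L (C ^ n * r) \<le> L (C * (C ^ n * r)) \<and> L (C * (C ^ n * r)) \<le> B * L (C ^ n * r)"
    unfolding L_def using growth r1(1) Suc.prems by (intro growth) linarith
  have "A * (A ^ n * L r) \<le> A * L (C ^ n * r)" "B * L (C ^ n * r) \<le> B * (B ^ n * L r)"
    using Suc A B by auto
  then show ?case using g by (simp add: mult.assoc)
qed simp

lemma L_doubling: "\<exists>K\<ge>1. \<forall>r s. r1 \<le> r \<longrightarrow> r1 \<le> s \<longrightarrow> s \<le> 16 * r \<longrightarrow> L s \<le> K * L r"
proof -
  obtain k where k: "16 < C ^ k" using real_arch_pow[OF C] by blast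
  show ?thesis
  proof (intro exI[of _ "B ^ k"] conjI allI impI)
    show "B ^ k \<ge> 1" using B by (intro one_le_power) simp
    fix r s assume rs: "r1 \<le> r" "r1 \<le> s" "s \<le> 16 * r"
    have "16 * r \<le> C ^ k * r" using k rs(1) r1_gt1 by (intro mult_right_mono) auto
    then have "L s \<le> L (C ^ k * r)" using rs by (intro L_mono) auto
    then show "L s \<le> B ^ k * L r" using L_C_power[OF rs(1), of k] by linarith
  qed
qed

lemma L_ge_ln: "\<exists>R0. \<forall>r\<ge>R0. T * ln r \<le> L r"
proof -
  define c where "c = \<bar>T\<bar> * (2 * ln C + ln r1) / L r1"
  have c: "c \<ge> 0" unfolding c_def using C r1_gt1 r1(2) by simp
  have "(\<lambda>n. real n / A ^ n) \<longlonglongrightarrow> 0" using A by (intro lim_n_over_pown) simp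
  then have "eventually (\<lambda>n. real n / A ^ n < 1 / (c + 1)) sequentially"
    using c by (intro order_tendstoD) auto
  then obtain n0 where n0: "real n / A ^ n < 1 / (c + 1)" if "n \<ge> n0" for n
    by (auto simp: eventually_sequentially)
  define R0 where "R0 = C ^ (n0 + 1) * r1"
  show ?thesis
  proof (intro exI[of _ R0] allI impI)
    fix r assume r: "r \<ge> R0"
    define n where "n = (LEAST n. r < C ^ n * r1)"
    obtain N where "r / r1 < C ^ N" using real_arch_pow[OF C] by blast
    then have ex: "\<exists>n. r < C ^ n * r1" using r1_gt1 by (auto simp: field_simps)
    have n: "r < C ^ n * r1" unfolding n_def by (rule LeastI_ex[OF ex])
    have "n > n0 + 1"
    proof (rule ccontr)
      assume "\<not> ?thesis"
      then have "C ^ n \<le> C ^ (n0 + 1)" using C by (intro power_increasing) auto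
      then have "C ^ n * r1 \<le> R0" unfolding R0_def using r1_gt1 by (intro mult_right_mono) auto
      then show False using n r by linarith
    qed
    then obtain m where m: "n = Suc m" "m > n0" by (cases n) auto
    have low: "C ^ m * r1 \<le> r"
      using not_less_Least[of m "\<lambda>n. r < C ^ n * r1"] m by (simp add: n_def not_less)
    have Cm: "1 * r1 \<le> C ^ m * r1" using C r1_gt1 by (intro mult_right_mono one_le_power) auto
    then have "r > 1" using low r1_gt1 by linarith
    have "A ^ m * L r1 \<le> L (C ^ m * r1)" using L_C_power[of r1 m] by simp
    also have "\<dots> \<le> L r" using low Cm by (intro L_mono) auto
    finally have 1: "A ^ m * L r1 \<le> L r" .
    have "ln r \<le> ln (C ^ n * r1)" using n \<open>r > 1\<close> by (intro ln_mono) auto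
    also have "\<dots> = real n * ln C + ln r1" using C r1_gt1 by (simp add: ln_mult ln_realpow)
    also have "\<dots> \<le> (2 * ln C + ln r1) * real m"
    proof -
      have "real n * ln C \<le> (2 * real m) * ln C" using m C by (intro mult_right_mono) auto
      moreover have "ln r1 * 1 \<le> ln r1 * real m" using m r1_gt1 by (intro mult_left_mono) auto
      ultimately show ?thesis by (simp add: algebra_simps)
    qed
    finally have "\<bar>T\<bar> * ln r \<le> \<bar>T\<bar> * ((2 * ln C + ln r1) * real m)" by (intro mult_left_mono) auto
    also have "\<dots> = c * real m * L r1" using r1(2) by (simp add: c_def)
    also have "c * real m \<le> A ^ m"
    proof -
      have "real m * (c + 1) < A ^ m" using n0[of m] m c A by (simp add: field_simps)
      then show ?thesis by (simp add: algebra_simps)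
    qed
    finally have "\<bar>T\<bar> * ln r \<le> A ^ m * L r1" using r1(2) by (simp add: mult_right_mono)
    moreover have "T * ln r \<le> \<bar>T\<bar> * ln r" using \<open>r > 1\<close> by (intro mult_right_mono) auto
    ultimately show "T * ln r \<le> L r" using 1 by linarith
  qed
qed

definition c where "c = (1 - 1 / A) * min 1 (ln (8/7) / ln C)"

lemma c_bounds: "0 < c" "c < 1"
proof -
  have *: "0 < 1 - 1 / A" "1 - 1 / A < 1" using A by auto
  have "0 < min 1 (ln (8/7) / ln C)" using C by simp
  then show "0 < c" unfolding c_def using * by (intro mult_pos_pos) auto
  have "c \<le> (1 - 1 / A) * 1" unfolding c_def using * by (intro mult_left_mono) auto
  also have "\<dots> < 1" using * by simp
  finally show "c < 1" .
qed

lemma norm_le_inner_disc: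
  assumes r: "r \<ge> C * r1" and z: "norm z \<le> 7/8 * r"
  shows "norm (f z) \<le> exp ((1 - c) * L r)"
proof -
  define s where "s = r / C"
  have s: "s \<ge> r1" "r = C * s" using r C by (auto simp: s_def field_simps)
  have "1 * s \<le> C * s" using C s(1) r1_gt1 by (intro mult_right_mono) auto
  then have rr: "r \<ge> r1" using s by linarith
  have Lr: "L r > 0" using rr by (rule L_pos)
  have "A * L s \<le> L r" using L_C_power[OF s(1), of 1] s(2) by simp
  then have Ls: "L s \<le> L r / A" using A by (simp add: field_simps)
  have A1: "1 - 1 / A \<ge> 0" using A by simp
  show ?thesis
  proof (cases "norm z \<le> s \<or> f z = 0")
    case True
    have "norm (f z) \<le> exp (L s)" if "norm z \<le> s"
      using norm_le_maxmod[OF continuous_f, of z] maxmod_mono[OF entire _ that] maxmod_eq[OF s(1)] by simp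
    moreover have "L s \<le> (1 - c) * L r"
    proof -
      have "c \<le> (1 - 1 / A) * 1" unfolding c_def using A1 by (intro mult_left_mono) auto
      then have "1 / A * L r \<le> (1 - c) * L r" using Lr by (intro mult_right_mono) auto
      then show ?thesis using Ls by simp
    qed
    ultimately show ?thesis using True by (auto intro: order_trans)
  next
    case False
    define \<alpha> where "\<alpha> = (1 - 1 / A) * L r / ln C"
    have lnC: "ln C > 0" using C by simp
    have s0: "s > 0" and r_pos: "r > 0" using s(1) rr r1_gt1 by auto
    have nz: "norm z > 0" using False s0 by linarith
    have \<alpha>: "\<alpha> \<ge> 0" unfolding \<alpha>_def using A1 Lr lnC by (intro divide_nonneg_pos mult_nonneg_nonneg) auto
    have "ln (norm (f z)) - \<alpha> * ln (norm z) \<le> max (L r / A - \<alpha> * ln s) (L r - \<alpha> * ln r)"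
    proof (rule three_circles[OF entire s0])
      show "s \<le> norm z" "norm z \<le> r" "f z \<noteq> 0" using False z r_pos by auto
      show "norm (f w) \<le> exp (L r / A)" if "norm w = s" for w
        using norm_le_maxmod[OF continuous_f, of w] that maxmod_eq[OF s(1)] Ls by (metis exp_le_cancel_iff order_trans)
      show "norm (f w) \<le> exp (L r)" if "norm w = r" for w
        using norm_le_maxmod[OF continuous_f, of w] that maxmod_eq[OF rr] by simp
    qed (rule \<alpha>)
    also have "L r / A - \<alpha> * ln s = L r - \<alpha> * ln r"
    proof -
      have "ln r = ln C + ln s" using s(2) s0 C by (simp add: ln_mult)
      moreover have "\<alpha> * ln C = (1 - 1 / A) * L r" using lnC by (simp add: \<alpha>_def)
      ultimately show ?thesis by (simp add: algebra_simps)
    qed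
    finally have "ln (norm (f z)) \<le> L r - \<alpha> * (ln r - ln (norm z))" by (simp add: algebra_simps)
    moreover have "ln (8/7) \<le> ln r - ln (norm z)"
    proof -
      have "8/7 \<le> r / norm z" using z nz by (simp add: field_simps)
      then have "ln (8/7) \<le> ln (r / norm z)" by (intro ln_mono) auto
      then show ?thesis using r_pos nz by (simp add: ln_div)
    qed
    then have "\<alpha> * ln (8/7) \<le> \<alpha> * (ln r - ln (norm z))" using \<alpha> by (intro mult_left_mono)
    moreover have "c * L r \<le> \<alpha> * ln (8/7)"
    proof -
      have "c \<le> (1 - 1 / A) * (ln (8/7) / ln C)" unfolding c_def using A1 by (intro mult_left_mono) auto
      then have "c * L r \<le> (1 - 1 / A) * (ln (8/7) / ln C) * L r" using Lr by (intro mult_right_mono) auto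
      then show ?thesis by (simp add: \<alpha>_def mult_ac)
    qed
    ultimately have "ln (norm (f z)) \<le> (1 - c) * L r" by (simp add: algebra_simps)
    then show ?thesis using False by (metis exp_le_cancel_iff exp_ln zero_less_norm_iff)
  qed
qed

lemma dens_Tset_bound:
  "\<exists>a1 a2 \<eta>. a1 > 0 \<and> a2 > 0 \<and> \<eta> > 0 \<and>
    (\<forall>q\<ge>0. \<forall>lam\<ge>0. \<exists>R0. \<forall>R\<ge>R0. dens (Tset f a1 a2 q lam) (annulus R) > \<eta>)"
proof -
  obtain K where K: "K \<ge> 1" and L_le: "\<And>r s. r1 \<le> r \<Longrightarrow> r1 \<le> s \<Longrightarrow> s \<le> 16 * r \<Longrightarrow> L s \<le> K * L r"
    using L_doubling by blast
  define \<beta> where "\<beta> = pi / 64 * c"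
  define s where "s = \<beta> / (64 * pi * K)"
  define e0 where "e0 = \<beta> / (4 * (24 * K + 2 * K / s))"
  define a where "a = 136 * K / e0"
  have \<beta>0: "\<beta> > 0" using c_bounds by (simp add: \<beta>_def)
  have s0: "s > 0" using \<beta>0 K by (simp add: s_def)
  have "24 * K + 2 * K / s > 0" using K s0 by (intro add_pos_pos) auto
  then have e00: "e0 > 0" unfolding e0_def using \<beta>0 by (intro divide_pos_pos) auto
  have a0: "a > 0" unfolding a_def using e00 K by simp
  define a1 where "a1 = \<beta> / (4 * K)"
  define a2 where "a2 = 2 * K * (24 * K + 2 * a)"
  define \<eta> where "\<eta> = e0 / (16 * pi)"
  have pos: "a1 > 0" "a2 > 0" "\<eta> > 0"
    using \<beta>0 K a0 e00 by (auto simp: a1_def a2_def \<eta>_def add_pos_pos)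
  have "\<exists>R0. \<forall>R\<ge>R0. dens (Tset f a1 a2 q lam) (annulus R) > \<eta>" if q: "q \<ge> 0" and lam: "lam \<ge> 0" for q lam
  proof -
    define l where "l = 2 * K * lam"
    have l: "l \<ge> 0" using K lam by (simp add: l_def)
    define T where "T = 8 * l + 32 * pi * K * l\<^sup>2 / e0 + 2 * lam + 2 * q / (1 - c)"
    have T: "8 * l \<le> T" "32 * pi * K * l\<^sup>2 / e0 \<le> T" "2 * lam \<le> T" "2 * q / (1 - c) \<le> T" "0 \<le> T"
      using l K e00 lam q c_bounds by (auto simp: T_def)
    obtain R1 where R1: "\<And>r. r \<ge> R1 \<Longrightarrow> T * ln r \<le> L r" using L_ge_ln by blast
    define R0 where "R0 = Max {R1, 4 * C * r1, 4}"
    have "dens (Tset f a1 a2 q lam) (annulus R) > \<eta>" if "R \<ge> R0" for R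
    proof -
      have R: "R \<ge> R1" "R \<ge> 4 * C * r1" "R \<ge> 4" using that by (auto simp: R0_def)
      have "1 * (4 * r1) \<le> C * (4 * r1)" using C r1_gt1 by (intro mult_right_mono) auto
      then have R': "R / 4 \<ge> r1" using R(2) by simp
      then have R'': "R \<ge> r1" "R > 0" using R(3) by auto
      define r where "r = 3 / 2 * R"
      have r: "r \<ge> r1" "r \<ge> C * r1" "r > 0" using R'' R C r1_gt1 by (auto simp: r_def)
      have "exp 1 \<le> (3::real)" by (rule exp_le)
      then have "1 \<le> ln r" using R(3) by (subst ln_ge_iff) (auto simp: r_def)
      have T_ln: "T \<le> T * ln x" if "x \<ge> R" for x
      proof -
        have "1 \<le> ln x" using \<open>exp 1 \<le> 3\<close> R(3) that by (subst ln_ge_iff) auto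
        then show ?thesis using T(5) mult_left_mono[of 1 "ln x" T] by simp
      qed
      have T_L: "T \<le> L x" if "x \<ge> R" for x
        using T_ln[OF that] R1[of x] that R(1) by linarith
      have Lr: "L r > 0" using r(1) by (rule L_pos)
      have T_Lr: "T \<le> L r" using R''(2) by (intro T_L) (simp add: r_def)
      obtain z0 where z0: "norm z0 = r" "norm (f z0) = maxmod f r"
        using maxmod_attained[OF continuous_f, of r] r(3) by (metis less_imp_le)
      define e where "e = z0 / of_real r"
      have e: "norm e = 1" using z0 r(3) by (simp add: e_def norm_divide)
      have z0_eq: "z0 = of_real r * e" using r(3) by (simp add: e_def)
      define F where "F \<zeta> = f (z0 + of_real R * \<zeta>)" for \<zeta>
      have F: "F holomorphic_on UNIV"
        unfolding F_def using entire
        by (intro holomorphic_on_compose_gen[of "\<lambda>\<zeta>. z0 + of_real R * \<zeta>" UNIV f UNIV, unfolded o_def]) (auto intro!: holomorphic_intros)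
      have dF: "deriv F \<zeta> = of_real R * deriv f (z0 + of_real R * \<zeta>)" for \<zeta>
      proof (rule DERIV_imp_deriv)
        have "(f has_field_derivative deriv f (z0 + of_real R * \<zeta>)) (at (z0 + of_real R * \<zeta>))"
          using entire by (intro holomorphic_derivI) auto
        moreover have "((\<lambda>\<zeta>. z0 + of_real R * \<zeta>) has_field_derivative of_real R) (at \<zeta>)"
          by (auto intro!: derivative_eq_intros)
        ultimately show "(F has_field_derivative of_real R * deriv f (z0 + of_real R * \<zeta>)) (at \<zeta>)"
          unfolding F_def by (rule DERIV_chain2[THEN DERIV_cong]) (rule mult.commute)
      qed
      have F0: "exp (L r) \<le> norm (F 0)" using z0 maxmod_eq[OF r(1)] by (simp add: F_def)
      have bd: "norm (F \<zeta>) \<le> exp (K * L r)" if "norm \<zeta> \<le> 3" for \<zeta>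
      proof -
        have "norm (z0 + of_real R * \<zeta>) \<le> r + R * 3"
          using that R''(2) z0(1) by (intro order_trans[OF norm_triangle_ineq] add_mono) (auto simp: norm_mult)
        then have "norm (F \<zeta>) \<le> maxmod f (3 * r)"
          unfolding F_def by (intro order_trans[OF norm_le_maxmod[OF continuous_f] maxmod_mono[OF entire]]) (auto simp: r_def)
        also have "\<dots> = exp (L (3 * r))" using r by (intro maxmod_eq) auto
        also have "\<dots> \<le> exp (K * L r)" using r by (simp add: L_le)
        finally show ?thesis .
      qed
      have small: "norm (F \<zeta>) \<le> exp ((1 - c) * L r)" if \<zeta>: "\<zeta> \<in> ball (- e / 4) (1/16)" for \<zeta>
        unfolding F_def
      proof (rule norm_le_inner_disc[OF r(2)])
        have "z0 + of_real R * \<zeta> = of_real (r - R / 4) * e + of_real R * (\<zeta> + e / 4)"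
          by (simp add: z0_eq algebra_simps)
        also have "norm \<dots> \<le> norm (of_real (r - R / 4) * e) + norm (of_real R * (\<zeta> + e / 4))"
          by (rule norm_triangle_ineq)
        also have "norm (of_real (r - R / 4) * e) = r - R / 4"
          using R''(2) e unfolding norm_mult norm_of_real by (simp add: r_def)
        also have "norm (of_real R * (\<zeta> + e / 4)) \<le> R * (1 / 16)"
        proof -
          have "norm (\<zeta> + e / 4) < 1 / 16" using \<zeta> by (simp add: dist_norm norm_minus_commute)
          then show ?thesis using R''(2) unfolding norm_mult norm_of_real by (intro mult_mono) auto
        qed
        finally show "norm (z0 + of_real R * \<zeta>) \<le> 7 / 8 * r" by (simp add: r_def)
      qed
      have l_cond: "8 * l \<le> L r" "32 * pi * K * l\<^sup>2 \<le> e0 * L r"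
      proof -
        show "8 * l \<le> L r" using T(1) T_Lr by linarith
        have "32 * pi * K * l\<^sup>2 / e0 \<le> L r" using T(2) T_Lr by linarith
        then show "32 * pi * K * l\<^sup>2 \<le> e0 * L r" using e00 by (simp add: field_simps)
      qed
      obtain G where G: "G \<in> sets borel" "G \<subseteq> ball 0 (3/8)" "ennreal (e0 / 2) \<le> emeasure lborel G"
        and G1: "\<And>z. z \<in> G \<Longrightarrow> exp ((1 - c) * L r) \<le> norm (F z)"
        and G2: "\<And>z. z \<in> G \<Longrightarrow> \<beta> / 4 * L r \<le> norm (deriv F z / F z)"
        and G3: "\<And>z w. z \<in> G \<Longrightarrow> dist w z \<le> l / L r \<Longrightarrow>
          norm w \<le> 1/2 \<and> F w \<noteq> 0 \<and> norm (deriv F w / F w) \<le> (24 * K + 2 * a) * L r"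
        by (rule good_set_large[OF F Lr F0 bd K c_bounds(1) e small \<beta>_def s_def e0_def a_def l l_cond]) blast+
      have Lx: "L r \<le> K * L x" "L x \<le> K * L r" if "R \<le> x" "x \<le> 2 * R" for x
        using that R'' r by (auto intro!: L_le simp: r_def)
      have sub: "(\<lambda>z. (z - z0) / of_real R) -` G \<subseteq> Tset f a1 a2 q lam \<inter> annulus R"
      proof
        fix z assume "z \<in> (\<lambda>z. (z - z0) / of_real R) -` G"
        then obtain \<zeta> where \<zeta>: "\<zeta> \<in> G" "z = z0 + of_real R * \<zeta>"
          using R''(2) by (auto simp: field_simps)
        have range: "R \<le> norm (z0 + of_real R * \<omega>) \<and> norm (z0 + of_real R * \<omega>) \<le> 2 * R" if "norm \<omega> \<le> 1/2" for \<omega>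
        proof -
          have "norm (of_real R * \<omega>) \<le> R * (1/2)"
            using that R''(2) unfolding norm_mult norm_of_real by (intro mult_mono) auto
          then show ?thesis
            using norm_triangle_ineq[of z0 "of_real R * \<omega>"] norm_diff_ineq[of z0 "of_real R * \<omega>"] z0(1)
            unfolding r_def by linarith
        qed
        have "norm \<zeta> \<le> 1/2" using G(2) \<zeta>(1) by auto
        from range[OF this] have nz: "R \<le> norm z" "norm z \<le> 2 * R" by (simp_all add: \<zeta>(2))
        have Lz: "L (norm z) > 0" using nz R'' by (intro L_pos) simp
        have near: "f w \<noteq> 0 \<and> norm (w * deriv f w / f w) \<le> a2 * L (norm w)"
          if w: "dist w z \<le> lam * norm z / L (norm z)" for w
        proof -
          define \<omega> where "\<omega> = (w - z0) / of_real R"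
          have w_eq: "w = z0 + of_real R * \<omega>" using R''(2) by (simp add: \<omega>_def)
          have "dist w z = R * dist \<omega> \<zeta>"
          proof -
            have "w - z = of_real R * (\<omega> - \<zeta>)" by (simp add: w_eq \<zeta>(2) algebra_simps)
            then show ?thesis using R''(2) by (simp only: dist_norm norm_mult norm_of_real abs_of_pos)
          qed
          moreover have "lam * norm z / L (norm z) \<le> R * (l / L r)"
          proof -
            have "L r / K \<le> L (norm z)" using Lx(1)[OF nz] K by (simp add: field_simps)
            then have "lam * norm z / L (norm z) \<le> lam * (2 * R) / (L r / K)"
              using nz lam Lr K R''(2) by (intro frac_le mult_left_mono) auto
            then show ?thesis by (simp add: l_def mult_ac)
          qed
          ultimately have "R * dist \<omega> \<zeta> \<le> R * (l / L r)" using w by linarith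
          then have "dist \<omega> \<zeta> \<le> l / L r" using R''(2) by (simp only: mult_le_cancel_left_pos)
          from G3[OF \<zeta>(1) this] have \<omega>: "norm \<omega> \<le> 1/2" "F \<omega> \<noteq> 0" "norm (deriv F \<omega> / F \<omega>) \<le> (24 * K + 2 * a) * L r"
            by auto
          have nw: "R \<le> norm w" "norm w \<le> 2 * R" using range[OF \<omega>(1)] by (simp_all add: w_eq)
          have "norm (w * deriv f w / f w) = norm w / R * norm (deriv F \<omega> / F \<omega>)"
            using R''(2) by (simp add: dF F_def w_eq[symmetric] norm_mult norm_divide)
          also have "\<dots> \<le> 2 * ((24 * K + 2 * a) * L r)"
            using \<omega>(3) nw R''(2) by (intro mult_mono) (auto simp: field_simps)
          also have "\<dots> \<le> 2 * ((24 * K + 2 * a) * (K * L (norm w)))"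
            using Lx(1)[OF nw] K a0 by (intro mult_left_mono) auto
          also have "\<dots> = a2 * L (norm w)" by (simp add: a2_def)
          finally show ?thesis using \<omega>(2) by (simp add: F_def w_eq[symmetric])
        qed
        have "a1 * L (norm z) \<le> norm (z * deriv f z / f z)"
        proof -
          have "a1 * L (norm z) \<le> a1 * (K * L r)" using Lx(2)[OF nz] pos by (intro mult_left_mono) auto
          also have "\<dots> = \<beta> / 4 * L r" using K by (simp add: a1_def)
          also have "\<dots> \<le> norm (deriv F \<zeta> / F \<zeta>)" by (rule G2[OF \<zeta>(1)])
          also have "\<dots> \<le> norm z / R * norm (deriv F \<zeta> / F \<zeta>)"
            using nz R''(2) mult_right_mono[of 1 "norm z / R" "norm (deriv F \<zeta> / F \<zeta>)"] by (simp add: field_simps)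
          also have "\<dots> = norm (z * deriv f z / f z)"
            using R''(2) by (simp add: dF F_def \<zeta>(2)[symmetric] norm_mult norm_divide)
          finally show ?thesis .
        qed
        moreover have "norm (z * deriv f z / f z) \<le> a2 * L (norm z)"
          using near[of z] lam Lz by simp
        moreover have "norm z powr q \<le> norm (f z)"
        proof -
          have z0: "norm z > 0" using nz R''(2) by linarith
          have "norm z \<le> r * r"
          proof -
            have "2 * R \<le> r * R" using R(3) by (intro mult_right_mono) (auto simp: r_def)
            also have "\<dots> \<le> r * r" using R''(2) by (intro mult_left_mono) (auto simp: r_def)
            finally show ?thesis using nz by simp
          qed
          then have "ln (norm z) \<le> ln (r * r)" using z0 by (intro ln_mono) auto
          also have "\<dots> = 2 * ln r" using r(3) by (simp add: ln_mult)
          finally have "q * ln (norm z) \<le> q * (2 * ln r)" using q by (intro mult_left_mono) auto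
          also have "\<dots> = (1 - c) * (2 * q / (1 - c) * ln r)" using c_bounds by simp
          also have "\<dots> \<le> (1 - c) * (T * ln r)"
            using c_bounds T(4) \<open>1 \<le> ln r\<close> by (intro mult_left_mono mult_right_mono) auto
          also have "\<dots> \<le> (1 - c) * L r"
            using c_bounds R(1) R''(2) by (intro mult_left_mono R1) (auto simp: r_def)
          finally have "norm z powr q \<le> exp ((1 - c) * L r)" using z0 by (simp add: powr_def)
          also have "\<dots> \<le> norm (f z)" using G1[OF \<zeta>(1)] by (simp add: F_def \<zeta>(2))
          finally show ?thesis .
        qed
        ultimately show "z \<in> Tset f a1 a2 q lam \<inter> annulus R"
          using near nz by (simp add: Tset_def annulus_def L_def)
      qed
      define X where "X = Tset f a1 a2 q lam \<inter> annulus R"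
      have X: "X \<in> sets borel"
        unfolding X_def
      proof (rule Tset_Int_annulus_borel[OF entire lam R''(2)])
        show "maxmod f x > 0" if "x > R / 4" for x using r1(3)[of x] that R' by linarith
        show "ln (maxmod f x) > 0 \<and> 2 * lam \<le> ln (maxmod f x)" if "x \<ge> R" for x
          using L_pos[of x] T_L[OF that] T(3) that R''(1) unfolding L_def by linarith
      qed
      have an: "annulus R \<in> sets borel" "annulus R \<subseteq> cball 0 (2 * R)"
        unfolding annulus_def by (measurable, auto)
      have ball: "emeasure lborel (cball (0::complex) (2 * R)) = ennreal (pi * (2 * R)\<^sup>2)"
        using R''(2) by (simp add: emeasure_cball unit_ball_vol_2 power2_eq_square)
      have an_le: "emeasure lborel (annulus R) \<le> ennreal (pi * (2 * R)\<^sup>2)"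
        using emeasure_mono[OF an(2), of lborel] ball by simp
      have X_an: "emeasure lborel X \<le> emeasure lborel (annulus R)"
        using an(1) by (intro emeasure_mono) (auto simp: X_def)
      have "ennreal (R\<^sup>2 * (e0 / 2)) \<le> ennreal (R\<^sup>2) * emeasure lborel G"
        using G(3) e00 by (subst ennreal_mult) (auto intro!: mult_left_mono)
      also have "\<dots> = emeasure lborel ((\<lambda>z. (z - z0) / of_real R) -` G)"
        by (rule emeasure_affine_image(2)[symmetric, OF G(1) R''(2)])
      also have "\<dots> \<le> emeasure lborel X" using X sub by (intro emeasure_mono) (auto simp: X_def)
      finally have X_ge: "ennreal (R\<^sup>2 * (e0 / 2)) \<le> emeasure lborel X" .
      have fin: "emeasure lborel (annulus R) < \<infinity>"
        by (rule le_less_trans[OF an_le]) simp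
      have finX: "emeasure lborel X < \<infinity>"
        by (rule le_less_trans[OF X_an fin])
      have m1: "measure lebesgue (annulus R) \<le> pi * (2 * R)\<^sup>2"
        using an an_le R''(2) by (simp add: measure_def enn2real_leI)
      have m2: "R\<^sup>2 * (e0 / 2) \<le> measure lebesgue X"
      proof -
        have "R\<^sup>2 * (e0 / 2) = enn2real (ennreal (R\<^sup>2 * (e0 / 2)))" using e00 by simp
        also have "\<dots> \<le> enn2real (emeasure lborel X)" using X_ge finX by (intro enn2real_mono) auto
        finally show ?thesis using X by (simp add: measure_def)
      qed
      have m3: "measure lebesgue X \<le> measure lebesgue (annulus R)"
        using X an X_an fin by (simp add: measure_def enn2real_mono)
      have m0: "0 < R\<^sup>2 * (e0 / 2)" using R''(2) e00 by simp
      have "\<eta> < e0 / (8 * pi)" using e00 by (simp add: \<eta>_def divide_strict_left_mono)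
      also have "\<dots> = R\<^sup>2 * (e0 / 2) / (pi * (2 * R)\<^sup>2)"
        using R''(2) by (simp add: power2_eq_square field_simps)
      also have "\<dots> \<le> measure lebesgue X / measure lebesgue (annulus R)"
        using m0 m1 m2 m3 by (intro frac_le) auto
      finally show ?thesis by (simp add: dens_def X_def)
    qed
    then show ?thesis by blast
  qed
  then show ?thesis using pos by blast
qed

end

theorem theorem2:
  fixes f :: "complex \<Rightarrow> complex" and A B C r0 :: real
  assumes entire: "f holomorphic_on UNIV"
    and nonconst: "\<not> (\<exists>c. \<forall>z. f z = c)"
    and A: "A > 1" and B: "B > 1" and C: "C > 1" and r0: "r0 > 1"
    and growth: "\<forall>r\<ge>r0. A * ln (maxmod f r) \<le> ln (maxmod f (C * r)) \<and>
                          ln (maxmod f (C * r)) \<le> B * ln (maxmod f r)"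
  shows "\<exists>a1 a2 \<eta>. a1 > 0 \<and> a2 > 0 \<and> \<eta> > 0 \<and>
           (\<forall>q\<ge>0. \<forall>lam\<ge>0. \<exists>R0. \<forall>R\<ge>R0. dens (Tset f a1 a2 q lam) (annulus R) > \<eta>)"
proof -
  interpret regular_growth f A B C r0
    using assms by unfold_locales auto
  show ?thesis by (rule dens_Tset_bound)
qed

end
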